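(* Let $n\ge 2$ and consider the system $$\dot x_i=f_i(x_1,\dots,x_i)+x_{i+1}\ (i=1,\dots,n-1),\qquad \dot x_n=f_n(x_1,\dots,x_n),\qquad y=x_1, \tag{T}$$ where $f_i:\mathbb{R}^i\to\mathbb{R}$ ($i=1,\dots,n$) are $C^1$ functions with $f_i(0)=0$ and there is a constant $L\ge0$ such that for $i=1,\dots,n$ $$|f_i(x_1,\dots,x_i)-f_i(z_1,\dots,z_i)|\le L\,|(x_1-z_1,\dots,x_i-z_i)|\qquad\forall (x_1,\dots,x_i),(z_1,\dots,z_i)\in\mathbb{R}^i .$$ Let $c=(1,0,\dots,0)'\in\mathbb{R}^n$ and let $A=\{a_{i,j}\}\in\mathbb{R}^{n\times n}$ be the matrix with $a_{i,i+1}=1$ for $i=1,\dots,n-1$ and $a_{i,j}=0$ otherwise. Let $k=(k_1,\dots,k_n)'\in\mathbb{R}^n$ be such that $A+kc'$ is Hurwitz, let $P\in\mathbb{R}^{n\times n}$ be a symmetric positive definite matrix and $\mu>0$ a constant such that $P(A+kc')+(A'+ck')P+2\mu I\le 0$, and let $K_1,K_2>0$ be constants such that $K_1|x|^2\le x'Px\le K_2|x|^2$ for all $x\in\mathbb{R}^n$. Let $\theta\ge\max\left(1,\frac{2|P|L\sqrt n}{\mu}\right)$. If the upper diameter $r>0$ of the sampling partition satisfies $$2r(L+\theta)\frac{|P|\,|k|}{\mu}\sqrt{\frac{K_2}{K_1}}<1,$$ then the system $$\begin{aligned} \dot z_i(t)&=f_i(z_1(t),\dots,z_i(t))+z_{i+1}(t)+\theta^i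 k_i\,(c'z(t)-w(t)),\quad i=1,\dots,n-1,\\ \dot z_n(t)&=f_n(z_1(t),\dots,z_n(t))+\theta^n k_n\,(c'z(t)-w(t)),\\ \dot w(t)&=f_1(z_1(t))+z_2(t),\qquad t\in[\tau_j,\tau_{j+1}),\\ w(\tau_{j+1})&=y(\tau_{j+1}),\\ \hat x&=z=(z_1,\dots,z_n)'\in\mathbb{R}^n, \end{aligned}$$ with state $(z(t),w(t))\in\mathbb{R}^n\times\mathbb{R}$ ($z$ being continuous at the sampling times $\tau_j$), is a robust sampled-data observer for (T) with respect to measurement errors.
   Context: Notation. $|\cdot|$ is the Euclidean norm of vectors and the induced norm of matrices; $'$ denotes transpose; $I$ is the identity matrix; $\mathbb{R}^+=[0,\infty)$. $K^+$ is the class of positive continuous functions on $\mathbb{R}^+$. $N$ is the class of non-decreasing continuous $\gamma:\mathbb{R}^+\to\mathbb{R}^+$ with $\gamma(0)=0$. $K$ is the class of continuous, increasing $\rho:\mathbb{R}^+\to\mathbb{R}^+$ with $\rho(0)=0$ and $\rho(s)>0$ for $s>0$; $K_\infty$ is the class of $\rho\in K$ with $\lim_{s\to\infty}\rho(s)=\infty$. $KL$ is the class of continuous $\sigma:\mathbb{R}^+\times\mathbb{R}^+\to\mathbb{R}^+$ such that $\sigma(\cdot,t)\in K$ for each $t\ge0$, and for each $s\ge 0$ the map $\sigma(s,\cdot)$ is non-increasing with $\lim_{t\to\infty}\sigma(s,t)=0$. $L^\infty_{loc}(\mathbb{R}^+;D)$ is the class of Lebesgue measurable and locally bounded maps $\mathbb{R}^+\to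 D$; $\sup$ always denotes the actual supremum, not the essential supremum. Robust sampled-data observer. Let $\dot x=f(x)$, $y=h(x)$ be a system with $x\in\mathbb{R}^n$, $y\in\mathbb{R}$, $f\in C^1$, $h\in C^2$, $f(0)=0$, $h(0)=0$. A sampled-data system with state $\zeta\in\mathbb{R}^m$ has the form $\dot\zeta(t)=g(\zeta(t),\zeta(\tau_j),y(\tau_j))$ for $t\in[\tau_j,\tau_{j+1})$, $\zeta(\tau_{j+1})=G\big(\lim_{t\to\tau_{j+1}^-}\zeta(t),y(\tau_{j+1})\big)$, $\hat x(t)=\Phi(\zeta(t))$, where $g\in C^1(\mathbb{R}^m\times\mathbb{R}^m\times\mathbb{R};\mathbb{R}^m)$, $G\in C^0(\mathbb{R}^m\times\mathbb{R};\mathbb{R}^m)$, $\Phi\in C^1(\mathbb{R}^m;\mathbb{R}^n)$, all vanishing at the origin. It is a robust sampled-data observer for $\dot x=f(x)$, $y=h(x)$ with respect to measurement errors, with upper diameter $r>0$ of the sampling partition, if: (i) there exist $\sigma\in KL$, $\gamma,p\in N$, $\tilde\mu\in K^+$, $a\in K_\infty$ such that for every $(x_0,\zeta_0,d,v)\in\mathbb{R}^n\times\mathbb{R}^m\times L^\infty_{loc}(\mathbb{R}^+;\mathbb{R}^+)\times L^\infty_{loc}(\mathbb{R}^+;\mathbb{R})$ the solution of the hybrid system $\dot x(t)=f(x(t))$; $\dot\zeta(t)=g(\zeta(t),\zeta(\tau_j),y(\tau_j)+v(\tau_j))$, $t\in[\tau_j,\tau_{j+1})$; $\zeta(\tau_{j+1})=G\big(\lim_{t\to\tau_{j+1}^-}\zeta(t),y(\tau_{j+1})+v(\tau_{j+1})\big)$;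 $\tau_0=0$, $\tau_{j+1}=\tau_j+r\exp(-d(\tau_j))$; $\hat x(t)=\Phi(\zeta(t))$, where $y=h(x)$, with $(x(0),\zeta(0))=(x_0,\zeta_0)$ satisfies, for all $t\ge0$, $|\hat x(t)-x(t)|\le\sigma(|x_0|+|\zeta_0|,t)+\sup_{0\le\tau\le t}\gamma(|v(\tau)|)$ and $|\zeta(t)|\le\tilde\mu(t)\big[a(|x_0|+|\zeta_0|)+\sup_{0\le\tau\le t}p(|v(\tau)|)\big]$; (ii) for every $x_0\in\mathbb{R}^n$ there exists $\zeta_0\in\mathbb{R}^m$ such that for all $d\in L^\infty_{loc}(\mathbb{R}^+;\mathbb{R}^+)$ the solution with $(x(0),\zeta(0))=(x_0,\zeta_0)$ and $v\equiv0$ satisfies $x(t)=\Phi(\zeta(t))$ for all $t\ge0$. For the observer in the claim, $\zeta=(z,w)$, $m=n+1$, $g$ is the right-hand side of the $(z,w)$ differential equations, $G((z,w),y)=(z,y)$ and $\Phi(z,w)=z$. *)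

theory Defs
  imports "HOL-Analysis.Analysis"
begin

section \<open>Comparison functions\<close>

text \<open>
  Functions on \<open>[0,\<infinity>)\<close> are represented by total functions on the reals of which only
  the values at nonnegative arguments matter.
\<close>

definition class_K_plus :: "(real \<Rightarrow> real) set" where
  "class_K_plus = {\<mu>. continuous_on {0..} \<mu> \<and> (\<forall>t\<ge>0. 0 < \<mu> t)}"

definition class_N :: "(real \<Rightarrow> real) set" where
  "class_N = {\<gamma>. continuous_on {0..} \<gamma> \<and> mono_on {0..} \<gamma> \<and> (\<forall>s\<ge>0. 0 \<le> \<gamma> s) \<and> \<gamma> 0 = 0}"

text \<open>``Increasing'', as opposed to ``non-decreasing'', is read as strictly increasing.\<close>

definition class_K :: "(real \<Rightarrow> real) set" where
  "class_K = {\<rho>. continuous_on {0..} \<rho> \<and> strict_mono_on {0..} \<rho> \<and> \<rho> 0 = 0 \<and> (\<forall>s>0. 0 < \<rho> s)}"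

definition class_K_inf :: "(real \<Rightarrow> real) set" where
  "class_K_inf = {\<rho> \<in> class_K. filterlim \<rho> at_top at_top}"

definition class_KL :: "(real \<Rightarrow> real \<Rightarrow> real) set" where
  "class_KL = {\<sigma>. continuous_on ({0..} \<times> {0..}) (\<lambda>(s, t). \<sigma> s t) \<and>
     (\<forall>s\<ge>0. \<forall>t\<ge>0. 0 \<le> \<sigma> s t) \<and>
     (\<forall>t\<ge>0. (\<lambda>s. \<sigma> s t) \<in> class_K) \<and>
     (\<forall>s\<ge>0. antimono_on {0..} (\<sigma> s) \<and> (\<sigma> s \<longlongrightarrow> 0) at_top)}"

text \<open>
  Measurable, locally bounded functions from \<open>[0,\<infinity>)\<close> to \<open>D\<close> (boundedness is pointwise, not
  up to null sets).
\<close>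

definition Linf_loc :: "real set \<Rightarrow> (real \<Rightarrow> real) set" where
  "Linf_loc D = {u. u \<in> borel_measurable (lebesgue_on {0..}) \<and>
     (\<forall>T\<ge>0. bounded (u ` {0..T})) \<and> (\<forall>t\<ge>0. u t \<in> D)}"


section \<open>Continuously differentiable maps\<close>

definition C1 :: "('a::real_normed_vector \<Rightarrow> 'b::real_normed_vector) \<Rightarrow> bool" where
  "C1 f \<longleftrightarrow> (\<exists>f' :: 'a \<Rightarrow> 'a \<Rightarrow>\<^sub>L 'b.
     (\<forall>x. (f has_derivative blinfun_apply (f' x)) (at x)) \<and> continuous_on UNIV f')"

definition C2 :: "('a::real_normed_vector \<Rightarrow> 'b::real_normed_vector) \<Rightarrow> bool" where
  "C2 f \<longleftrightarrow> (\<exists>f' :: 'a \<Rightarrow> 'a \<Rightarrow>\<^sub>L 'b.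
     (\<forall>x. (f has_derivative blinfun_apply (f' x)) (at x)) \<and> C1 f')"


section \<open>Robust sampled-data observers\<close>

primrec sampling_time :: "real \<Rightarrow> (real \<Rightarrow> real) \<Rightarrow> nat \<Rightarrow> real" where
  "sampling_time r d 0 = 0"
| "sampling_time r d (Suc j) = sampling_time r d j + r * exp (- d (sampling_time r d j))"

text \<open>
  A global solution on \<open>[0,\<infinity>)\<close> of the interconnection of the system \<open>x' = f x\<close>, \<open>y = h x\<close>
  with the sampled-data system \<open>(g, G)\<close>.  At a sampling time the derivative of \<open>\<zeta>\<close> is the
  right derivative, and the left limit of \<open>\<zeta>\<close> is required to exist.
\<close>

definition hybrid_solution ::
  "('x::euclidean_space \<Rightarrow> 'x) \<Rightarrow> ('x \<Rightarrow> real) \<Rightarrow>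
   ('z::euclidean_space \<times> 'z \<times> real \<Rightarrow> 'z) \<Rightarrow> ('z \<times> real \<Rightarrow> 'z) \<Rightarrow> real \<Rightarrow>
   'x \<Rightarrow> 'z \<Rightarrow> (real \<Rightarrow> real) \<Rightarrow> (real \<Rightarrow> real) \<Rightarrow> (real \<Rightarrow> 'x) \<Rightarrow> (real \<Rightarrow> 'z) \<Rightarrow> bool"
where
  "hybrid_solution f h g G r x0 \<zeta>0 d v x \<zeta> \<longleftrightarrow>
     (let \<tau> = sampling_time r d in
       x 0 = x0 \<and> \<zeta> 0 = \<zeta>0 \<and>
       (\<forall>t\<ge>0. (x has_vector_derivative f (x t)) (at t within {0..})) \<and>
       (\<forall>j. \<forall>t\<in>{\<tau> j..<\<tau> (Suc j)}.
          (\<zeta> has_vector_derivative g (\<zeta> t, \<zeta> (\<tau> j), h (x (\<tau> j)) + v (\<tau> j)))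
            (at t within {\<tau> j..<\<tau> (Suc j)})) \<and>
       (\<forall>j. \<exists>l. (\<zeta> \<longlongrightarrow> l) (at_left (\<tau> (Suc j))) \<and>
          \<zeta> (\<tau> (Suc j)) = G (l, h (x (\<tau> (Suc j))) + v (\<tau> (Suc j)))))"

text \<open>
  ``The solution satisfies \<open>Q\<close> for all times'': a global solution exists, and every global
  solution satisfies \<open>Q\<close>.
\<close>

definition the_solution_satisfies ::
  "('x::euclidean_space \<Rightarrow> 'x) \<Rightarrow> ('x \<Rightarrow> real) \<Rightarrow>
   ('z::euclidean_space \<times> 'z \<times> real \<Rightarrow> 'z) \<Rightarrow> ('z \<times> real \<Rightarrow> 'z) \<Rightarrow> real \<Rightarrow>
   'x \<Rightarrow> 'z \<Rightarrow> (real \<Rightarrow> real) \<Rightarrow> (real \<Rightarrow> real) \<Rightarrow>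
   ((real \<Rightarrow> 'x) \<Rightarrow> (real \<Rightarrow> 'z) \<Rightarrow> bool) \<Rightarrow> bool"
where
  "the_solution_satisfies f h g G r x0 \<zeta>0 d v Q \<longleftrightarrow>
     (\<exists>x \<zeta>. hybrid_solution f h g G r x0 \<zeta>0 d v x \<zeta>) \<and>
     (\<forall>x \<zeta>. hybrid_solution f h g G r x0 \<zeta>0 d v x \<zeta> \<longrightarrow> Q x \<zeta>)"

definition robust_sampled_data_observer ::
  "('x::euclidean_space \<Rightarrow> 'x) \<Rightarrow> ('x \<Rightarrow> real) \<Rightarrow> real \<Rightarrow>
   ('z::euclidean_space \<times> 'z \<times> real \<Rightarrow> 'z) \<Rightarrow> ('z \<times> real \<Rightarrow> 'z) \<Rightarrow> ('z \<Rightarrow> 'x) \<Rightarrow> bool"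
where
  "robust_sampled_data_observer f h r g G \<Phi> \<longleftrightarrow>
     (C1 f \<and> C2 h \<and> f 0 = 0 \<and> h 0 = 0) \<and>
     (C1 g \<and> continuous_on UNIV G \<and> C1 \<Phi> \<and> g 0 = 0 \<and> G 0 = 0 \<and> \<Phi> 0 = 0) \<and>
     0 < r \<and>
     (\<exists>\<sigma>\<in>class_KL. \<exists>\<gamma>\<in>class_N. \<exists>p\<in>class_N. \<exists>\<mu>\<in>class_K_plus. \<exists>a\<in>class_K_inf.
        \<forall>x0 \<zeta>0. \<forall>d\<in>Linf_loc {0..}. \<forall>v\<in>Linf_loc UNIV.
          the_solution_satisfies f h g G r x0 \<zeta>0 d v (\<lambda>x \<zeta>. \<forall>t\<ge>0.
            norm (\<Phi> (\<zeta> t) - x t)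
              \<le> \<sigma> (norm x0 + norm \<zeta>0) t + (SUP s\<in>{0..t}. \<gamma> \<bar>v s\<bar>) \<and>
            norm (\<zeta> t)
              \<le> \<mu> t * (a (norm x0 + norm \<zeta>0) + (SUP s\<in>{0..t}. p \<bar>v s\<bar>)))) \<and>
     (\<forall>x0. \<exists>\<zeta>0. \<forall>d\<in>Linf_loc {0..}.
        the_solution_satisfies f h g G r x0 \<zeta>0 d (\<lambda>_. 0) (\<lambda>x \<zeta>. \<forall>t\<ge>0. x t = \<Phi> (\<zeta> t)))"


section \<open>Numbered coordinates\<close>

text \<open>
  The coordinates of \<^typ>\<open>real^'n\<close> are numbered from 1 to \<^term>\<open>CARD('n)\<close> along the linear
  order of the index type: \<open>pos i\<close> is the number of the index \<open>i\<close>, and \<open>idx k\<close> is the index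
  with number \<open>k\<close>, so that the \<open>k\<close>-th coordinate of \<open>x\<close> is \<open>x $ idx k\<close>.
\<close>

definition pos :: "'n::{finite,linorder} \<Rightarrow> nat" where
  "pos i = card {..i}"

definition idx :: "nat \<Rightarrow> 'n::{finite,linorder}" where
  "idx = inv pos"

lemma pos_less_iff: "pos i < pos j \<longleftrightarrow> i < j" for i j :: "'n::{finite,linorder}"
proof -
  have *: "pos a < pos b" if "a < b" for a b :: 'n
    unfolding pos_def using that by (intro psubset_card_mono) auto
  show ?thesis
    by (metis * less_asym' neq_iff)
qed

lemma inj_pos: "inj (pos :: 'n::{finite,linorder} \<Rightarrow> nat)"
  by (rule injI) (metis neq_iff pos_less_iff)

lemma bij_betw_pos: "bij_betw (pos :: 'n::{finite,linorder} \<Rightarrow> nat) UNIV {1..CARD('n)}"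
proof -
  have "pos ` (UNIV :: 'n set) \<subseteq> {1..CARD('n)}"
    unfolding pos_def by (auto simp: Suc_le_eq card_gt_0_iff intro!: card_mono[where B = UNIV])
  moreover have "card (pos ` (UNIV :: 'n set)) = card {1..CARD('n)}"
    by (simp add: card_image inj_pos)
  ultimately have "pos ` (UNIV :: 'n set) = {1..CARD('n)}"
    by (intro card_subset_eq) auto
  then show ?thesis
    by (simp add: bij_betw_def inj_pos)
qed

lemma idx_pos [simp]: "idx (pos i) = i"
  by (simp add: idx_def inj_pos)

lemma pos_idx:
  assumes "1 \<le> k" "k \<le> CARD('n)"
  shows "pos (idx k :: 'n::{finite,linorder}) = k"
proof -
  have "k \<in> range (pos :: 'n \<Rightarrow> nat)"
    using bij_betw_pos[where 'n='n] assms by (auto simp: bij_betw_def)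
  then show ?thesis by (auto simp: idx_def f_inv_into_f)
qed

definition next_coord :: "real^'n::{finite,linorder} \<Rightarrow> 'n \<Rightarrow> real" where
  "next_coord x i = (if pos i < CARD('n) then x $ idx (pos i + 1) else 0)"

text \<open>
  A function of the first \<open>i\<close> coordinates is represented by a function on the whole space
  that does not depend on the other coordinates.
\<close>

definition depends_on_upto :: "'n::{finite,linorder} \<Rightarrow> (real^'n::_ \<Rightarrow> real) \<Rightarrow> bool" where
  "depends_on_upto i \<phi> \<longleftrightarrow> (\<forall>x z. (\<forall>j\<le>i. x $ j = z $ j) \<longrightarrow> \<phi> x = \<phi> z)"


section \<open>The triangular system and its observer\<close>

definition triangular_field ::
  "('n::{finite,linorder} \<Rightarrow> real^'n::_ \<Rightarrow> real) \<Rightarrow> real^'n::_ \<Rightarrow> real^'n::_"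
where
  "triangular_field f x = (\<chi> i. f i x + next_coord x i)"

definition first_coord :: "real^'n::{finite,linorder} \<Rightarrow> real" where
  "first_coord x = x $ idx 1"

definition c_vec :: "real^'n::{finite,linorder}" where
  "c_vec = axis (idx 1) 1"

definition A_mat :: "real^'n::{finite,linorder}^'n::_" where
  "A_mat = (\<chi> i j. if pos j = pos i + 1 then 1 else 0)"

definition outer :: "real^'m \<Rightarrow> real^'n \<Rightarrow> real^'n^'m" where
  "outer u v = (\<chi> i j. u $ i * v $ j)"

definition complex_eigenvalue :: "real^'n^'n \<Rightarrow> complex \<Rightarrow> bool" where
  "complex_eigenvalue M s \<longleftrightarrow>
     (\<exists>v. v \<noteq> 0 \<and> (\<chi> i j. complex_of_real (M $ i $ j)) *v v = s *s v)"

definition hurwitz :: "real^'n^'n \<Rightarrow> bool" where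
  "hurwitz M \<longleftrightarrow> (\<forall>s. complex_eigenvalue M s \<longrightarrow> Re s < 0)"

definition symmetric_matrix :: "real^'n^'n \<Rightarrow> bool" where
  "symmetric_matrix M \<longleftrightarrow> transpose M = M"

definition positive_definite :: "real^'n^'n \<Rightarrow> bool" where
  "positive_definite M \<longleftrightarrow> (\<forall>x. x \<noteq> 0 \<longrightarrow> 0 < x \<bullet> (M *v x))"

definition negative_semidefinite :: "real^'n^'n \<Rightarrow> bool" where
  "negative_semidefinite M \<longleftrightarrow> (\<forall>x. x \<bullet> (M *v x) \<le> 0)"

text \<open>The matrix norm induced by the Euclidean norm (\<^const>\<open>norm\<close> is the Frobenius norm).\<close>

definition matrix_norm :: "real^'n^'m \<Rightarrow> real" where
  "matrix_norm M = onorm (\<lambda>x. M *v x)"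

text \<open>The observer state is \<open>\<zeta> = (z, w)\<close>; its flow uses neither \<open>\<zeta> (\<tau> j)\<close> nor \<open>y (\<tau> j)\<close>.\<close>

definition observer_flow ::
  "('n::{finite,linorder} \<Rightarrow> real^'n::_ \<Rightarrow> real) \<Rightarrow> real^'n::_ \<Rightarrow> real \<Rightarrow>
   ((real^'n::_) \<times> real) \<times> ((real^'n::_) \<times> real) \<times> real \<Rightarrow> (real^'n::_) \<times> real"
where
  "observer_flow f k \<theta> = (\<lambda>((z, w), _, _).
     ((\<chi> i. f i z + next_coord z i + \<theta> ^ pos i * k $ i * (c_vec \<bullet> z - w)),
      f (idx 1) z + z $ idx 2))"

definition observer_jump :: "((real^'n) \<times> real) \<times> real \<Rightarrow> (real^'n) \<times> real" where
  "observer_jump = (\<lambda>((z, w), y). (z, y))"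

end

(*
  The scaled error xi_i = (z_i - x_i) / theta^i and the output mismatch eta = w - x_1 satisfy
  xi' = theta (A + k c') xi + F - eta k with |F| <= L sqrt(n) |xi|, so that V = xi' P xi obeys
    V' <= - mu theta |xi|^2 + 2 |P| |k| |xi| |eta|,
  while |eta'| <= theta (L + theta) |xi| between sampling times and eta = v right after a sampling.
  The condition on r is a small-gain condition for this loop: with phi(t) = M (s0 exp(- c t) + S),
  M large and c small, V can never cross phi^2, since at a first contact the bound on eta
  over one sampling interval makes the right derivative of V smaller than that of phi^2.
  Right derivatives suffice, and they exist at the sampling times as well.
*)
theory Submission
  imports Defs
begin

section \<open>A sampled small-gain estimate\<close>

text \<open>The obstacle is that the bound on \<open>\<eta>\<close> at time t involves the error
  over the whole current sampling interval, so the inequality for V is not a differential inequality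
  in V(t) alone. At a contact time this circularity is harmless: up to that time the history obeys V
  <= phi^2 by construction. The loop gain is a product of three factors: r theta (L + theta) from xi
  to eta over one interval, 2 |P| |k| / (mu theta) from eta to xi, at the balance of the two terms
  of V', and sqrt(K2 / K1) for passing between V and |xi|. Here theta cancels once, and the product
  is exactly the left-hand side of the condition on r. Its strictness pays for the decay rate c, for
  the factor exp(c r) of looking back in time, and for a term of order 1/M caused by the value of
  eta at the last sampling. The comparison function must be strictly positive, also for vanishing
  initial error and noise. It is therefore started at the initial error plus an epsilon that is
  removed afterwards. This lets one and the same estimate give both the decay and, with all data
  zero, exact reproduction of the state.\<close>

lemma nonpos_if_right_derivative_neg_at_zeros:
  fixes W :: "real \<Rightarrow> real"
  assumes cont: "continuous_on {0..T} W" and W0: "W 0 \<le> 0"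
    and step: "\<And>t. \<lbrakk>0 \<le> t; t < T; \<And>s. \<lbrakk>0 \<le> s; s \<le> t\<rbrakk> \<Longrightarrow> W s \<le> 0; W t = 0\<rbrakk>
      \<Longrightarrow> \<exists>b>t. \<exists>D<0. (W has_real_derivative D) (at t within {t..<b})"
    and t: "t \<in> {0..T}"
  shows "W t \<le> 0"
proof (rule ccontr)
  assume neg: "\<not> W t \<le> 0"
  \<comment> \<open>The supremum a of these times ends the largest initial interval on which W is
    nonpositive. If W t were positive, then a < t, and the interval could still be prolonged past
    a.\<close>
  define S where "S = {a \<in> {0..t}. \<forall>s\<in>{0..a}. W s \<le> 0}"
  define a where "a = Sup S"
  have S0: "0 \<in> S" using t W0 by (auto simp: S_def)
  have bdd: "bdd_above S" unfolding S_def by (rule bdd_aboveI[of _ t]) auto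
  have a0: "0 \<le> a" unfolding a_def by (rule cSup_upper[OF S0 bdd])
  have at: "a \<le> t" unfolding a_def by (rule cSup_least) (use S0 in \<open>auto simp: S_def\<close>)
  have below: "W s \<le> 0" if "0 \<le> s" "s < a" for s
  proof -
    obtain b where "b \<in> S" "s < b"
      using \<open>s < a\<close> less_cSup_iff[OF _ bdd, of s] S0 unfolding a_def by blast
    then show ?thesis using that by (auto simp: S_def)
  qed
  have Wa: "W a \<le> 0"
  proof (cases "a = 0")
    case False
    have "continuous (at a within {0..T}) W"
      using cont a0 at t by (auto simp: continuous_on_eq_continuous_within)
    then have "(W \<longlongrightarrow> W a) (at a within {0..T})" by (simp add: continuous_within)
    then have "(W \<longlongrightarrow> W a) (at a within {0..a})"
      by (rule tendsto_within_subset) (use at t in auto)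
    then have "(W \<longlongrightarrow> W a) (at_left a)"
      using False a0 by (simp add: at_within_Icc_at_left)
    moreover have "eventually (\<lambda>s. W s \<le> 0) (at_left a)"
      using False a0 below by (subst eventually_at_left[of 0]) (auto intro!: exI[of _ 0])
    ultimately show ?thesis by (rule tendsto_upperbound) simp
  qed (use W0 in simp)
  have upto: "W s \<le> 0" if "0 \<le> s" "s \<le> a" for s
    using below[of s] Wa that by (cases "s = a") auto
  have a_lt: "a < t" using Wa neg at by (cases "a = t") auto
  \<comment> \<open>Where W vanishes at a, the negative right derivative pushes W below zero just
    after a; where W is negative, continuity keeps it so.\<close>
  have "\<exists>d>0. \<forall>h. 0 < h \<and> h < d \<longrightarrow> W (a + h) \<le> 0"
  proof (cases "W a = 0")
    case True
    obtain b D where b: "b > a" "D < 0" "(W has_real_derivative D) (at a within {a..<b})"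
      using step[of a] a0 a_lt t upto True by auto
    obtain d where d: "d > 0" "\<And>h. h > 0 \<Longrightarrow> a + h \<in> {a..<b} \<Longrightarrow> h < d \<Longrightarrow> W (a + h) < W a"
      using has_real_derivative_neg_dec_right[OF b(3,2)] by auto
    have "\<forall>h. 0 < h \<and> h < min d (b - a) \<longrightarrow> W (a + h) \<le> 0"
    proof (intro allI impI)
      fix h assume "0 < h \<and> h < min d (b - a)"
      then have "W (a + h) < W a" by (intro d(2)) auto
      then show "W (a + h) \<le> 0" using True by simp
    qed
    then show ?thesis using d(1) b(1) by (intro exI[of _ "min d (b - a)"]) auto
  next
    case False
    have "continuous (at a within {0..T}) W"
      using cont a0 at t by (auto simp: continuous_on_eq_continuous_within)
    then have "\<exists>d>0. \<forall>y\<in>{0..T}. dist y a < d \<longrightarrow> dist (W y) (W a) < - W a"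
      using False Wa unfolding continuous_within_eps_delta by (metis less_eq_real_def neg_0_less_iff_less)
    then obtain d where d: "d > 0" "\<And>y. y \<in> {0..T} \<Longrightarrow> dist y a < d \<Longrightarrow> dist (W y) (W a) < - W a"
      by auto
    have "\<forall>h. 0 < h \<and> h < min d (t - a) \<longrightarrow> W (a + h) \<le> 0"
    proof (intro allI impI)
      fix h assume "0 < h \<and> h < min d (t - a)"
      then have "dist (W (a + h)) (W a) < - W a"
        using a0 t by (intro d(2)) (auto simp: dist_real_def)
      then show "W (a + h) \<le> 0" by (auto simp: dist_real_def)
    qed
    then show ?thesis using d(1) a_lt by (intro exI[of _ "min d (t - a)"]) auto
  qed
  then obtain d where d: "d > 0" "\<And>h. 0 < h \<Longrightarrow> h < d \<Longrightarrow> W (a + h) \<le> 0" by blast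
  define h where "h = min (d / 2) (t - a)"
  have h: "0 < h" "h < d" "h \<le> t - a" using d(1) a_lt by (auto simp: h_def min_def)
  have "W s \<le> 0" if "0 \<le> s" "s \<le> a + h" for s
    using upto[of s] d(2)[of "s - a"] h that by (cases "s \<le> a") auto
  then have "a + h \<in> S" using h a0 by (auto simp: S_def)
  then have "a + h \<le> a" unfolding a_def by (rule cSup_upper[OF _ bdd])
  then show False using h by simp
qed

lemma sampling_interval_exists:
  fixes \<tau> :: "nat \<Rightarrow> real"
  assumes "\<tau> 0 = 0" "\<forall>B. \<exists>j. B < \<tau> j" "0 \<le> t"
  obtains j where "t \<in> {\<tau> j..<\<tau> (Suc j)}"
proof -
  define j where "j = (LEAST j. t < \<tau> j)"
  have j: "t < \<tau> j" unfolding j_def by (rule LeastI_ex) (use assms in auto)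
  then have "j \<noteq> 0" using assms by (cases j) auto
  then obtain i where i: "j = Suc i" by (cases j) auto
  have "\<not> t < \<tau> i" using not_less_Least[of i "\<lambda>j. t < \<tau> j"] i unfolding j_def by simp
  then show ?thesis using that[of i] j i by auto
qed

text \<open>Scalar core of the argument, free of vectors: \<open>\<rho>\<close> stands for the norm
  of the scaled error, \<open>\<eta>\<close> for the output mismatch, \<open>\<kappa>\<close> and
  \<open>\<beta>\<close> for the two gains of the loop, \<open>\<alpha>\<close> for the dissipation.
  The assumption \<open>reset\<close> allows the decaying term besides S because at time 0 no
  sampling takes place and the mismatch is whatever the initial state makes it. The requirement
  \<open>sqrt K2 \<le> M\<close> places V below the comparison function at time 0, and
  \<open>0 < s0\<close> keeps that function positive.\<close>

lemma sampled_small_gain: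
  fixes V \<rho> \<eta> V' \<eta>' :: "real \<Rightarrow> real" and \<tau> :: "nat \<Rightarrow> real"
  assumes K: "0 < K1" "0 < K2" and const: "0 \<le> \<kappa>" "0 \<le> \<beta>" "0 < \<alpha>" "0 < c" "0 < M"
    and M: "sqrt K2 \<le> M"
    and gain: "(\<beta> * \<kappa> * r / sqrt K1 + \<beta> / M) * exp (c * r) + 2 * c * sqrt K2 < \<alpha> / sqrt K2"
    and tau: "\<tau> 0 = 0" "\<forall>B. \<exists>j. B < \<tau> j" "\<And>j. \<tau> (Suc j) \<le> \<tau> j + r"
      "\<And>j. 0 \<le> \<tau> j"
    and V_cont: "continuous_on {0..} V"
    and V_bounds: "\<And>t. 0 \<le> t \<Longrightarrow> K1 * (\<rho> t)\<^sup>2 \<le> V t \<and> V t \<le> K2 * (\<rho> t)\<^sup>2"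
    and \<rho>: "\<And>t. 0 \<le> \<rho> t"
    and V': "\<And>j t. t \<in> {\<tau> j..<\<tau> (Suc j)} \<Longrightarrow>
      (V has_real_derivative V' t) (at t within {\<tau> j..<\<tau> (Suc j)})"
    and V'_le: "\<And>t. 0 \<le> t \<Longrightarrow> V' t \<le> - \<alpha> * (\<rho> t)\<^sup>2 + \<beta> * \<rho> t * \<bar>\<eta> t\<bar>"
    and \<eta>': "\<And>j t. t \<in> {\<tau> j..<\<tau> (Suc j)} \<Longrightarrow>
      (\<eta> has_real_derivative \<eta>' t) (at t within {\<tau> j..<\<tau> (Suc j)})"
    and \<eta>'_le: "\<And>t. 0 \<le> t \<Longrightarrow> \<bar>\<eta>' t\<bar> \<le> \<kappa> * \<rho> t"
    and s0: "0 < s0" "\<rho> 0 \<le> s0" and S: "0 \<le> S"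
    and reset: "\<And>j. \<tau> j \<le> T \<Longrightarrow> \<bar>\<eta> (\<tau> j)\<bar> \<le> s0 * exp (- c * \<tau> j) + S"
    and t: "t \<in> {0..T}"
  shows "\<rho> t \<le> M / sqrt K1 * (s0 * exp (- c * t) + S) \<and>
    \<bar>\<eta> t\<bar> \<le> exp (c * r) * (1 + r * \<kappa> * M / sqrt K1) * (s0 * exp (- c * t) + S)"
proof -
  define B where "B t = s0 * exp (- c * t) + S" for t
  have Bpos: "0 < B t" for t using s0 S by (simp add: B_def add_pos_nonneg)
  \<comment> \<open>A bound holding at an earlier time of the same sampling interval costs at most
    the factor exp(c r) when it is expressed at the present time.\<close>
  have B_shift: "B s \<le> exp (c * r) * B t" if "t - r \<le> s" "s \<le> t" for s t
  proof -
    have "c * (t - s) \<le> c * r" using that const by (intro mult_left_mono) auto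
    then have "exp (- c * s) \<le> exp (c * r) * exp (- c * t)"
      unfolding exp_add[symmetric] by (simp add: algebra_simps)
    then have "s0 * exp (- c * s) \<le> s0 * (exp (c * r) * exp (- c * t))"
      using s0 by (intro mult_left_mono) auto
    moreover have "S \<le> exp (c * r) * S"
    proof -
      have "0 \<le> r" using that by linarith
      then have "1 \<le> exp (c * r)" using const by simp
      then show ?thesis using mult_right_mono[of 1 "exp (c * r)" S] S by simp
    qed
    ultimately show ?thesis by (simp add: B_def algebra_simps)
  qed
  have \<rho>_of_V: "\<rho> s \<le> M / sqrt K1 * B s" if "0 \<le> s" "V s \<le> (M * B s)\<^sup>2" for s
  proof -
    have "(sqrt K1 * \<rho> s)\<^sup>2 = K1 * (\<rho> s)\<^sup>2" using K by (simp add: power_mult_distrib)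
    also have "\<dots> \<le> (M * B s)\<^sup>2"
      using V_bounds[OF that(1)] that(2) by (meson order_trans)
    finally have "(sqrt K1 * \<rho> s)\<^sup>2 \<le> (M * B s)\<^sup>2" .
    then have "sqrt K1 * \<rho> s \<le> M * B s"
      by (rule power2_le_imp_le) (use Bpos[of s] const in simp)
    then show ?thesis using K by (simp add: field_simps)
  qed
  \<comment> \<open>Mean value inequality from the last sampling time on: a reset value plus at most
    r times the largest slope, with both moved to the present time by
    \<open>B_shift\<close>.\<close>
  have \<eta>_bound: "\<bar>\<eta> t\<bar> \<le> exp (c * r) * (1 + r * \<kappa> * M / sqrt K1) * B t"
    if t: "0 \<le> t" "t \<le> T" and upto: "\<And>s. \<lbrakk>0 \<le> s; s \<le> t\<rbrakk> \<Longrightarrow> V s \<le> (M * B s)\<^sup>2" for t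
  proof -
    obtain j where j: "t \<in> {\<tau> j..<\<tau> (Suc j)}"
      using sampling_interval_exists[OF tau(1,2) t(1)] by blast
    define Q where "Q = \<kappa> * (M / sqrt K1 * (exp (c * r) * B t))"
    have Q: "\<bar>\<eta>' s\<bar> \<le> Q" if "s \<in> {\<tau> j..t}" for s
    proof -
      have s: "0 \<le> s" "s \<le> t" "t - r \<le> s" using that j tau(4)[of j] tau(3)[of j] by auto
      have "\<bar>\<eta>' s\<bar> \<le> \<kappa> * \<rho> s" using \<eta>'_le s by auto
      also have "\<dots> \<le> \<kappa> * (M / sqrt K1 * B s)"
        using const \<rho>_of_V upto s by (intro mult_left_mono) auto
      also have "\<dots> \<le> Q" unfolding Q_def
        using const K s B_shift by (intro mult_left_mono) auto
      finally show ?thesis .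
    qed
    have "norm (\<eta> t - \<eta> (\<tau> j)) \<le> Q * norm (t - \<tau> j)"
    proof (rule field_differentiable_bound[where S = "{\<tau> j..t}" and f' = \<eta>'])
      fix s assume s: "s \<in> {\<tau> j..t}"
      show "(\<eta> has_real_derivative \<eta>' s) (at s within {\<tau> j..t})"
        by (rule has_field_derivative_subset[OF \<eta>'[of s j]]) (use s j in auto)
    qed (use Q j in auto)
    also have "\<dots> \<le> Q * r"
      using j tau(3)[of j] const K Bpos[of t] by (intro mult_left_mono) (auto simp: Q_def)
    finally have "\<bar>\<eta> t\<bar> \<le> \<bar>\<eta> (\<tau> j)\<bar> + Q * r" by auto
    also have "\<dots> \<le> B (\<tau> j) + Q * r" using reset[of j] j t by (auto simp: B_def)
    also have "\<dots> \<le> exp (c * r) * B t + Q * r"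
      using B_shift[of t "\<tau> j"] j tau(3)[of j] by auto
    also have "\<dots> = exp (c * r) * (1 + r * \<kappa> * M / sqrt K1) * B t"
      by (simp add: Q_def algebra_simps)
    finally show ?thesis .
  qed
  define W where "W t = V t - (M * B t)\<^sup>2" for t
  have cont: "continuous_on {0..T} W"
    unfolding W_def B_def by (intro continuous_intros continuous_on_subset[OF V_cont]) auto
  have W0: "W 0 \<le> 0"
  proof -
    have "V 0 \<le> (sqrt K2 * \<rho> 0)\<^sup>2" using V_bounds[of 0] K by (simp add: power_mult_distrib)
    also have "\<dots> \<le> (M * B 0)\<^sup>2"
      using M const s0 S \<rho>[of 0] K by (intro power_mono mult_mono) (auto simp: B_def)
    finally show ?thesis by (simp add: W_def)
  qed
  have W_le: "W t \<le> 0" if "t \<in> {0..T}" for t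
  proof (rule nonpos_if_right_derivative_neg_at_zeros[OF cont W0 _ that])
    fix t assume t: "0 \<le> t" "t < T" and upto: "\<And>s. 0 \<le> s \<Longrightarrow> s \<le> t \<Longrightarrow> W s \<le> 0" and "W t = 0"
    obtain j where j: "t \<in> {\<tau> j..<\<tau> (Suc j)}"
      using sampling_interval_exists[OF tau(1,2) t(1)] by blast
    let ?D = "V' t - 2 * (M * B t) * (M * (s0 * (- c * exp (- c * t))))"
    have "(V has_real_derivative V' t) (at t within {t..<\<tau> (Suc j)})"
      by (rule has_field_derivative_subset[OF V'[OF j]]) (use j in auto)
    then have der: "(W has_real_derivative ?D) (at t within {t..<\<tau> (Suc j)})"
      unfolding W_def B_def by (auto intro!: derivative_eq_intros simp: algebra_simps)
    let ?\<phi> = "M * B t"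
    have \<phi>: "0 < ?\<phi>" using const Bpos by simp
    have Vt: "V t = ?\<phi>\<^sup>2" using \<open>W t = 0\<close> by (simp add: W_def)
    have "?\<phi>\<^sup>2 \<le> K2 * (\<rho> t)\<^sup>2" using V_bounds[OF t(1)] unfolding Vt by blast
    also have "\<dots> = (sqrt K2 * \<rho> t)\<^sup>2" using K by (simp add: power_mult_distrib)
    finally have "?\<phi>\<^sup>2 \<le> (sqrt K2 * \<rho> t)\<^sup>2" .
    then have "?\<phi> \<le> sqrt K2 * \<rho> t" by (rule power2_le_imp_le) (use \<rho>[of t] K in simp)
    then have \<rho>_ge: "?\<phi> / sqrt K2 \<le> \<rho> t" using K by (simp add: field_simps)
    have "\<bar>\<eta> t\<bar> \<le> exp (c * r) * (1 + r * \<kappa> * M / sqrt K1) * B t"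
      using \<eta>_bound[of t] t upto by (auto simp: W_def)
    then have "\<beta> * \<bar>\<eta> t\<bar> \<le> \<beta> * (exp (c * r) * (1 + r * \<kappa> * M / sqrt K1) * B t)"
      using const by (intro mult_left_mono) auto
    \<comment> \<open>In units of \<open>M * B t\<close> the reset value weighs only
      \<open>\<beta> / M\<close>, whereas the slope term keeps the loop gain; a large M thus leaves
      the loop gain alone.\<close>
    also have "\<dots> = (\<beta> * \<kappa> * r / sqrt K1 + \<beta> / M) * exp (c * r) * ?\<phi>"
      using const by (simp add: field_simps)
    also have "\<dots> < (\<alpha> / sqrt K2 - 2 * c * sqrt K2) * ?\<phi>"
      using gain \<phi> by (intro mult_strict_right_mono) auto
    also have "\<dots> = \<alpha> * (?\<phi> / sqrt K2) - 2 * c * sqrt K2 * ?\<phi>" by (simp add: algebra_simps)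
    also have "\<dots> \<le> \<alpha> * \<rho> t - 2 * c * sqrt K2 * ?\<phi>"
      using mult_left_mono[OF \<rho>_ge, of \<alpha>] const by simp
    finally have 1: "2 * c * sqrt K2 * ?\<phi> < \<alpha> * \<rho> t - \<beta> * \<bar>\<eta> t\<bar>" by simp
    have 2: "0 < 2 * c * sqrt K2 * ?\<phi>" using \<phi> const K by simp
    \<comment> \<open>The product of the two lower bounds is \<open>2 * c * ?\<phi>\<^sup>2\<close>,
      since the roots cancel. This explains the summand \<open>2 * c * sqrt K2\<close> in
      \<open>gain\<close>.\<close>
    have "?\<phi> / sqrt K2 * (2 * c * sqrt K2 * ?\<phi>) < \<rho> t * (\<alpha> * \<rho> t - \<beta> * \<bar>\<eta> t\<bar>)"
    proof (rule mult_le_less_imp_less[OF \<rho>_ge 1])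
    qed (use \<phi> K 2 in auto)
    moreover have "?\<phi> / sqrt K2 * (2 * c * sqrt K2 * ?\<phi>) = 2 * c * ?\<phi>\<^sup>2"
      using K by (simp add: field_simps power2_eq_square)
    ultimately have "2 * c * ?\<phi>\<^sup>2 < \<rho> t * (\<alpha> * \<rho> t - \<beta> * \<bar>\<eta> t\<bar>)" by simp
    moreover have "\<rho> t * (\<alpha> * \<rho> t - \<beta> * \<bar>\<eta> t\<bar>) \<le> - V' t"
      using V'_le[OF t(1)] by (simp add: algebra_simps power2_eq_square)
    \<comment> \<open>The squared comparison function falls at relative rate at most 2c, because
      only its part \<open>s0 * exp (- c * t)\<close> decays and S is nonnegative. The decrease of V
      just shown is strictly faster.\<close>
    moreover have "2 * ?\<phi> * (M * (s0 * (c * exp (- c * t)))) \<le> 2 * c * ?\<phi>\<^sup>2"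
    proof -
      have "c * (M * (s0 * exp (- c * t))) \<le> c * ?\<phi>"
        using const S by (intro mult_left_mono) (auto simp: B_def)
      then have "2 * ?\<phi> * (c * (M * (s0 * exp (- c * t)))) \<le> 2 * ?\<phi> * (c * ?\<phi>)"
        by (rule mult_left_mono) (use \<phi> in simp)
      then show ?thesis by (simp add: power2_eq_square algebra_simps)
    qed
    ultimately have "?D < 0" by simp
    with der j show "\<exists>b>t. \<exists>D<0. (W has_real_derivative D) (at t within {t..<b})"
      by (intro exI[of _ "\<tau> (Suc j)"] conjI exI[of _ ?D]) auto
  qed
  have upto: "V s \<le> (M * B s)\<^sup>2" if "0 \<le> s" "s \<le> t" for s
    using W_le[of s] that t by (auto simp: W_def)
  show ?thesis using \<rho>_of_V[of t] \<eta>_bound[of t] upto t by (auto simp: B_def)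
qed

text \<open>M has to be fixed before c: for fixed M the left-hand side tends to q + \<beta> / M as c
  falls to 0, and this limit is already below a once M is large.\<close>

lemma small_gain_constants:
  fixes a q \<beta> K r :: real
  assumes "q < a"
  obtains c M :: real where "0 < c" "0 < M" "K \<le> M" "(q + \<beta> / M) * exp (c * r) + 2 * c * K < a"
proof -
  have "((\<lambda>M. q + \<beta> / M) \<longlongrightarrow> q + 0) at_top"
    by (intro tendsto_intros tendsto_divide_0[OF tendsto_const] filterlim_at_top_imp_at_infinity filterlim_ident)
  then have "eventually (\<lambda>M. q + \<beta> / M < a) at_top" using assms by (auto dest: order_tendstoD(2))
  then have "eventually (\<lambda>M. q + \<beta> / M < a \<and> 0 < M \<and> K \<le> M) at_top"
    by (intro eventually_conj eventually_gt_at_top eventually_ge_at_top)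
  then obtain M where M: "q + \<beta> / M < a" "0 < M" "K \<le> M"
    using eventually_happens[of _ "at_top :: real filter"] by auto
  have "((\<lambda>c. (q + \<beta> / M) * exp (c * r) + 2 * c * K) \<longlongrightarrow> (q + \<beta> / M) * exp (0 * r) + 2 * 0 * K) (at_right 0)"
    by (intro tendsto_intros)
  then have "eventually (\<lambda>c. (q + \<beta> / M) * exp (c * r) + 2 * c * K < a) (at_right 0)"
    using M by (auto dest: order_tendstoD(2))
  then have "eventually (\<lambda>c. (q + \<beta> / M) * exp (c * r) + 2 * c * K < a \<and> 0 < c) (at_right 0)"
    by (intro eventually_conj eventually_at_right_less)
  then obtain c where "(q + \<beta> / M) * exp (c * r) + 2 * c * K < a \<and> 0 < c"
    using eventually_happens[of _ "at_right (0::real)"] by auto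
  then show ?thesis using that[of c M] M by auto
qed

section \<open>Global solutions of Lipschitz differential equations\<close>

text \<open>
  The Picard operator acts on \<open>y t = exp (- \<lambda> t) *\<^sub>R x t\<close>, a bounded function once
  \<open>\<lambda>\<close> exceeds the Lipschitz constant, so that a single fixed point argument gives a solution
  on all of \<open>[0,\<infinity>)\<close>.
\<close>

lemma global_solution_exists:
  fixes F :: "'a::euclidean_space \<Rightarrow> 'a"
  assumes lip: "C-lipschitz_on UNIV F" and F0: "F 0 = 0"
  shows "\<exists>x. x 0 = x0 \<and> (\<forall>t\<ge>0. (x has_vector_derivative F (x t)) (at t within {0..}))"
proof -
  \<comment> \<open>The factor 2 makes the contraction constant C / l at most 1/2, and the summand 1
    keeps l positive when C is 0.\<close>
  define l where "l = 2 * C + 1"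
  have C: "0 \<le> C" using lip by (rule lipschitz_on_nonneg)
  have l: "0 < l" "2 * C \<le> l" using C by (auto simp: l_def)
  define G where "G y u = F (exp (l * u) *\<^sub>R y u)" for y :: "real \<Rightarrow>\<^sub>C 'a" and u :: real
  define I where "I y t = integral {0..t} (G y)" for y :: "real \<Rightarrow>\<^sub>C 'a" and t :: real
  \<comment> \<open>The Banach space in use consists of bounded continuous functions on the whole
    line. Replacing t by \<open>max 0 t\<close> extends the operator to negative times by the
    constant x0.\<close>
  define R where "R y t = exp (- l * max 0 t) *\<^sub>R (x0 + I y (max 0 t))"
    for y :: "real \<Rightarrow>\<^sub>C 'a" and t :: real
  have contF: "continuous_on UNIV F" using lip by (rule lipschitz_on_continuous_on)
  have contG: "continuous_on A (G y)" for y A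
    unfolding G_def
    by (intro continuous_on_compose2[OF contF] continuous_intros) auto
  have intG: "G y integrable_on {0..t}" for y t
    by (intro integrable_continuous_real contG)
  have exp_int: "((\<lambda>u. exp (l * u)) has_integral (exp (l * t) - 1) / l) {0..t}" if "0 \<le> t" for t
  proof -
    have "((\<lambda>u. exp (l * u)) has_integral exp (l * t) / l - exp (l * 0) / l) {0..t}"
      by (rule fundamental_theorem_of_calculus[OF that])
        (use l in \<open>auto intro!: derivative_eq_intros simp: has_real_derivative_iff_has_vector_derivative[symmetric]\<close>)
    then show ?thesis by (simp add: diff_divide_distrib)
  qed
  \<comment> \<open>The integrand grows like exp(l u), so its integral carries a factor 1 / l and
    the weight exp(- l t) removes the growth; what remains is b * C / l.\<close>
  have exp_int_le: "exp (- l * t) * (C * b * ((exp (l * t) - 1) / l)) \<le> b / 2"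
    if "0 \<le> t" "0 \<le> b" for t b
  proof -
    have "exp (- l * t) * (C * b * ((exp (l * t) - 1) / l)) = C / l * b * (1 - exp (- l * t))"
    proof -
      have "exp (- l * t) * exp (l * t) = 1" by (simp flip: exp_add)
      then have "exp (- l * t) * (exp (l * t) - 1) = 1 - exp (- l * t)"
        by (simp add: right_diff_distrib)
      then show ?thesis by (metis (no_types, lifting) mult.assoc mult.commute times_divide_eq_right)
    qed
    also have "\<dots> \<le> 1 / 2 * b * 1"
      using that l C by (intro mult_mono mult_nonneg_nonneg) (auto simp: divide_le_eq)
    finally show ?thesis by simp
  qed
  have G_diff: "norm (G y u - G z u) \<le> C * dist y z * exp (l * u)" for y z u
  proof -
    have "norm (G y u - G z u) \<le> C * norm (exp (l * u) *\<^sub>R y u - exp (l * u) *\<^sub>R z u)"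
      unfolding G_def by (rule lipschitz_on_normD[OF lip]) auto
    also have "norm (exp (l * u) *\<^sub>R y u - exp (l * u) *\<^sub>R z u) = exp (l * u) * dist (y u) (z u)"
      by (simp add: dist_norm flip: scaleR_diff_right)
    also have "\<dots> \<le> exp (l * u) * dist y z"
      by (intro mult_left_mono dist_bounded) auto
    finally show ?thesis using C by (simp add: mult.assoc mult.commute[of "dist y z"] mult_left_mono)
  qed
  have R_diff: "norm (R y t - R z t) \<le> dist y z / 2" for y z t
  proof -
    let ?t = "max 0 t"
    have "norm (I y ?t - I z ?t) = norm (integral {0..?t} (\<lambda>u. G y u - G z u))"
      unfolding I_def by (subst integral_diff[OF intG intG]) simp
    also have "\<dots> \<le> integral {0..?t} (\<lambda>u. C * dist y z * exp (l * u))"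
      by (intro integral_norm_bound_integral integrable_diff intG G_diff integrable_continuous_real
          continuous_intros)
    also have "\<dots> = C * dist y z * ((exp (l * ?t) - 1) / l)"
      by (rule integral_unique[OF has_integral_mult_right[OF exp_int]]) simp
    finally have "exp (- l * ?t) * norm (I y ?t - I z ?t)
        \<le> exp (- l * ?t) * (C * dist y z * ((exp (l * ?t) - 1) / l))"
      by (rule mult_left_mono) simp
    also have "\<dots> \<le> dist y z / 2" by (rule exp_int_le) auto
    finally show ?thesis by (simp add: R_def flip: scaleR_diff_right)
  qed
  have R_cont: "continuous_on UNIV (R y)" for y
  proof -
    have I_cont: "continuous_on {0..b} (I y)" for b
      unfolding I_def by (rule indefinite_integral_continuous_1[OF intG])
    have "continuous_on {0..} (I y)"
    proof (rule continuous_on_eq_continuous_within[THEN iffD2], rule ballI)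
      fix t :: real assume "t \<in> {0..}"
      then have "continuous (at t within {0..t + 1}) (I y)"
        using I_cont[of "t + 1"] by (auto simp: continuous_on_eq_continuous_within)
      moreover have "at t within {0..t + 1} = at t within {0..}"
        by (rule at_within_nhd[of _ "{..<t + 1}"]) auto
      ultimately show "continuous (at t within {0..}) (I y)" by simp
    qed
    then have "continuous_on UNIV (\<lambda>t. I y (max 0 t))"
      by (rule continuous_on_compose2) (intro continuous_intros, auto)
    then show ?thesis unfolding R_def by (intro continuous_intros)
  qed
  \<comment> \<open>Here F 0 = 0 enters: the zero function has a bounded image, and the contraction
    estimate then bounds every other image.\<close>
  have R_zero: "norm (R 0 t) \<le> norm x0" for t
  proof -
    have "I 0 s = 0" for s by (simp add: I_def G_def[abs_def] F0)
    moreover have "exp (- l * max 0 t) * norm x0 \<le> 1 * norm x0"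
      using l by (intro mult_right_mono) auto
    ultimately show ?thesis by (simp add: R_def)
  qed
  have R_bcont: "R y \<in> bcontfun" for y
  proof -
    have "norm (R y t) \<le> norm x0 + dist y 0 / 2" for t
      using R_diff[of y t 0] R_zero[of t] norm_triangle_sub[of "R y t" "R 0 t"] by linarith
    then have "bounded (range (R y))" by (auto simp: bounded_iff)
    then show ?thesis using R_cont by (auto simp: bcontfun_def)
  qed
  define Q where "Q y = Bcontfun (R y)" for y
  have Q: "apply_bcontfun (Q y) = R y" for y
    unfolding Q_def using R_bcont by (rule Bcontfun_inverse)
  have "\<exists>!y. Q y = y"
  proof (rule banach_fix_type[of "1/2"])
    show "\<forall>x y. dist (Q x) (Q y) \<le> 1 / 2 * dist x y"
    proof (intro allI dist_bound)
      fix y z t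
      show "dist (Q y t) (Q z t) \<le> 1 / 2 * dist y z"
        using R_diff[of y t z] unfolding Q dist_norm by simp
    qed
  qed auto
  then obtain y where y: "Q y = y" by auto
  define x where "x t = x0 + I y t" for t
  have yx: "exp (l * t) *\<^sub>R y t = x t" if "0 \<le> t" for t
  proof -
    have "y t = R y t" using y Q by metis
    then show ?thesis using that by (simp add: R_def x_def flip: exp_add)
  qed
  have "(x has_vector_derivative F (x t)) (at t within {0..})" if "0 \<le> t" for t
  proof -
    have "(I y has_vector_derivative G y t) (at t within {0..t + 1})"
      unfolding I_def by (rule integral_has_vector_derivative[OF contG]) (use that in auto)
    moreover have "at t within {0..t + 1} = at t within {0..}"
      by (rule at_within_nhd[of _ "{..<t + 1}"]) auto
    moreover have "G y t = F (x t)" using yx[OF that] by (simp add: G_def)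
    ultimately show ?thesis unfolding x_def by (auto intro!: derivative_eq_intros)
  qed
  moreover have "x 0 = x0" by (simp add: x_def I_def)
  ultimately show ?thesis by blast
qed

text \<open>Gronwall without integrals: |x|^2 exp(- 2 C t) does not increase, since F 0 = 0 turns
  the Lipschitz condition into linear growth. The bound is needed because the plant itself may be
  unstable, so the observer state can only be bounded with a growing factor.\<close>

lemma solution_exp_bound:
  fixes F :: "'a::euclidean_space \<Rightarrow> 'a"
  assumes lip: "C-lipschitz_on UNIV F" and F0: "F 0 = 0"
    and x: "\<And>t. 0 \<le> t \<Longrightarrow> (x has_vector_derivative F (x t)) (at t within {0..})"
    and t: "0 \<le> t"
  shows "norm (x t) \<le> exp (C * t) * norm (x 0)"
proof -
  have F_le: "norm (F a) \<le> C * norm a" for a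
    using lipschitz_on_normD[OF lip, of a 0] by (simp add: F0)
  define w where "w s = (x s \<bullet> x s) * exp (- 2 * C * s)" for s
  have "w t \<le> w 0"
  proof (rule DERIV_nonpos_imp_decreasing_open[OF t])
    fix s assume s: "0 < s" "s < t"
    have "(x has_vector_derivative F (x s)) (at s)"
      using x[of s] s at_within_interior[of s "{0..}"] by simp
    then have "(x has_derivative (\<lambda>h. h *\<^sub>R F (x s))) (at s)" by (simp add: has_vector_derivative_def)
    then have "((\<lambda>s. x s \<bullet> x s) has_derivative (\<lambda>h. x s \<bullet> (h *\<^sub>R F (x s)) + (h *\<^sub>R F (x s)) \<bullet> x s)) (at s)"
      by (intro has_derivative_inner)
    then have "((\<lambda>s. x s \<bullet> x s) has_real_derivative 2 * (x s \<bullet> F (x s))) (at s)"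
      unfolding has_field_derivative_def
      by (rule has_derivative_eq_rhs) (auto simp: inner_commute algebra_simps)
    then have "(w has_real_derivative (2 * (x s \<bullet> F (x s)) - 2 * C * (x s \<bullet> x s)) * exp (- 2 * C * s)) (at s)"
      unfolding w_def by (auto intro!: derivative_eq_intros simp: algebra_simps)
    moreover have "x s \<bullet> F (x s) \<le> C * (x s \<bullet> x s)"
    proof -
      have "x s \<bullet> F (x s) \<le> norm (x s) * norm (F (x s))" by (rule norm_cauchy_schwarz)
      also have "\<dots> \<le> norm (x s) * (C * norm (x s))" by (intro mult_left_mono F_le) auto
      finally show ?thesis by (simp add: dot_square_norm power2_eq_square algebra_simps)
    qed
    ultimately show "\<exists>D. (w has_real_derivative D) (at s) \<and> D \<le> 0"
      by (intro exI conjI) (auto simp: mult_nonpos_nonneg)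
  next
    have "continuous_on {0..} x"
      using x by (auto simp: continuous_on_eq_continuous_within intro: has_vector_derivative_continuous)
    then show "continuous_on {0..t} w"
      unfolding w_def by (intro continuous_intros) (auto intro: continuous_on_subset)
  qed
  then have "(norm (x t))\<^sup>2 * exp (- 2 * C * t) \<le> (norm (x 0))\<^sup>2"
    by (simp add: w_def dot_square_norm)
  then have "(norm (x t))\<^sup>2 * exp (- 2 * C * t) * exp (2 * C * t) \<le> (norm (x 0))\<^sup>2 * exp (2 * C * t)"
    by (rule mult_right_mono) simp
  moreover have "(exp (C * t))\<^sup>2 = exp (2 * C * t)"
    by (simp add: power2_eq_square flip: exp_add)
  ultimately have "(norm (x t))\<^sup>2 \<le> (exp (C * t) * norm (x 0))\<^sup>2"
    by (simp add: power_mult_distrib mult.assoc flip: exp_add) (simp add: mult.commute)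
  then show ?thesis by (rule power2_le_imp_le) simp
qed

section \<open>Smoothness and Lipschitz continuity of the vector fields\<close>

lemma C1_bounded_linear:
  assumes "bounded_linear T"
  shows "C1 T"
  unfolding C1_def using assms
  by (intro exI[of _ "\<lambda>_. Blinfun T"])
    (simp add: bounded_linear_Blinfun_apply bounded_linear_imp_has_derivative)

lemma C2_bounded_linear:
  assumes "bounded_linear T"
  shows "C2 T"
  unfolding C2_def using assms
  by (intro exI[of _ "\<lambda>_. Blinfun T"])
    (auto simp: bounded_linear_Blinfun_apply bounded_linear_imp_has_derivative C1_def
      zero_blinfun.rep_eq intro!: exI[of _ "\<lambda>_. 0"])

lemma C1_add:
  assumes "C1 f" "C1 g"
  shows "C1 (\<lambda>x. f x + g x)"
proof -
  obtain f' g' where "\<And>x. (f has_derivative blinfun_apply (f' x)) (at x)" "continuous_on UNIV f'"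
    "\<And>x. (g has_derivative blinfun_apply (g' x)) (at x)" "continuous_on UNIV g'"
    using assms unfolding C1_def by blast
  then show ?thesis unfolding C1_def
    by (intro exI[of _ "\<lambda>x. f' x + g' x"])
      (auto intro!: continuous_on_add has_derivative_add simp: plus_blinfun.rep_eq)
qed

lemma C1_linear_comp:
  assumes "bounded_linear T" "C1 f"
  shows "C1 (\<lambda>x. T (f x))"
proof -
  obtain f' where f': "\<And>x. (f has_derivative blinfun_apply (f' x)) (at x)" "continuous_on UNIV f'"
    using assms unfolding C1_def by blast
  have "((\<lambda>x. T (f x)) has_derivative blinfun_apply (Blinfun T o\<^sub>L f' x)) (at x)" for x
    using bounded_linear.has_derivative[OF assms(1) f'(1)]
    by (simp add: bounded_linear_Blinfun_apply assms blinfun_compose.rep_eq comp_def)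
  moreover have "continuous_on UNIV (\<lambda>x. Blinfun T o\<^sub>L f' x)"
    by (intro bounded_bilinear.continuous_on[OF bounded_bilinear_blinfun_compose] f' continuous_on_const)
  ultimately show ?thesis unfolding C1_def by (intro exI[of _ "\<lambda>x. Blinfun T o\<^sub>L f' x"]) blast
qed

lemma C1_comp_linear:
  assumes "bounded_linear T" "C1 f"
  shows "C1 (\<lambda>x. f (T x))"
proof -
  obtain f' where f': "\<And>x. (f has_derivative blinfun_apply (f' x)) (at x)" "continuous_on UNIV f'"
    using assms unfolding C1_def by blast
  have "((\<lambda>x. f (T x)) has_derivative blinfun_apply (f' (T x) o\<^sub>L Blinfun T)) (at x)" for x
    using diff_chain_at[OF bounded_linear_imp_has_derivative[OF assms(1)] f'(1)]
    by (simp add: bounded_linear_Blinfun_apply assms blinfun_compose.rep_eq comp_def)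
  moreover have "continuous_on UNIV (\<lambda>x. f' (T x) o\<^sub>L Blinfun T)"
    by (intro bounded_bilinear.continuous_on[OF bounded_bilinear_blinfun_compose] continuous_on_const
        continuous_on_compose2[OF f'(2)] linear_continuous_on assms) auto
  ultimately show ?thesis unfolding C1_def by (intro exI[of _ "\<lambda>x. f' (T x) o\<^sub>L Blinfun T"]) blast
qed

lemma C1_sum:
  assumes "\<And>i. i \<in> A \<Longrightarrow> C1 (f i)"
  shows "C1 (\<lambda>x. \<Sum>i\<in>A. f i x)"
  using assms
  by (induction A rule: infinite_finite_induct)
    (auto intro: C1_add C1_bounded_linear[OF bounded_linear_zero])

lemma lipschitz_on_sum:
  fixes f :: "'i \<Rightarrow> 'a::metric_space \<Rightarrow> 'b::real_normed_vector"
  assumes "\<And>i. i \<in> A \<Longrightarrow> (C i)-lipschitz_on U (f i)"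
  shows "(\<Sum>i\<in>A. C i)-lipschitz_on U (\<lambda>x. \<Sum>i\<in>A. f i x)"
  using assms
  by (induction A rule: infinite_finite_induct) (auto intro: lipschitz_on_add lipschitz_on_constant)

lemma bounded_linear_imp_lipschitz:
  assumes "bounded_linear T"
  obtains C where "C-lipschitz_on UNIV T"
  using bounded_linear.lipschitz_boundE[OF assms] by metis

lemma next_coord_add: "next_coord (x + y) i = next_coord x i + next_coord y i"
  and next_coord_diff: "next_coord (x - y) i = next_coord x i - next_coord y i"
  and next_coord_scaleR: "next_coord (c *\<^sub>R x) i = c * next_coord x i"
  by (auto simp: next_coord_def)

lemma bounded_linear_next_coords: "bounded_linear (\<lambda>x. \<chi> i. next_coord x i)"
  by (intro linear_conv_bounded_linear[THEN iffD1] linearI)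
    (auto simp: vec_eq_iff next_coord_add next_coord_scaleR)

text \<open>A sum of scalar functions times fixed vectors plus a linear map: in this form smoothness
  and Lipschitz continuity follow from closure under sums and composition with linear maps.\<close>

lemma triangular_field_eq:
  "triangular_field f x = (\<Sum>i\<in>UNIV. f i x *\<^sub>R axis i 1) + (\<chi> i. next_coord x i)"
  using basis_expansion[of "\<chi> i. f i x"]
  by (simp add: triangular_field_def vec_eq_iff scalar_mult_eq_scaleR)

text \<open>What is left of the observer flow after all terms with some \<open>f i\<close> are split
  off, namely chain coupling, output injection and the z_2 term of the predictor.\<close>

definition observer_linear_part ::
  "real^'n::{finite,linorder} \<Rightarrow> real \<Rightarrow> (real^'n::_) \<times> real \<Rightarrow> (real^'n::_) \<times> real" where
  "observer_linear_part k \<theta> = (\<lambda>(z, w).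
     ((\<chi> i. next_coord z i + \<theta> ^ pos i * k $ i * (c_vec \<bullet> z - w)), z $ idx 2))"

lemma bounded_linear_observer_linear_part: "bounded_linear (observer_linear_part k \<theta>)"
  by (intro linear_conv_bounded_linear[THEN iffD1] linearI)
    (auto simp: observer_linear_part_def vec_eq_iff next_coord_add next_coord_scaleR inner_add_right algebra_simps)

lemma observer_flow_eq:
  "observer_flow f k \<theta> p = (\<Sum>i\<in>UNIV. f i (fst (fst p)) *\<^sub>R (axis i 1, 0))
     + f (idx 1) (fst (fst p)) *\<^sub>R (0, 1) + observer_linear_part k \<theta> (fst p)"
proof -
  have "(\<Sum>i\<in>UNIV. f i z *\<^sub>R (axis i 1, 0 :: real)) = ((\<chi> i. f i z), 0)" for z
    using basis_expansion[of "\<chi> i. f i z"]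
    by (intro prod_eqI) (simp_all add: fst_sum snd_sum scalar_mult_eq_scaleR)
  then show ?thesis
    by (simp add: observer_flow_def observer_linear_part_def vec_eq_iff split_beta)
qed

lemma C1_triangular_field:
  assumes "\<And>i. C1 (f i)"
  shows "C1 (triangular_field f)"
  unfolding triangular_field_eq[abs_def]
  by (intro C1_add C1_sum C1_linear_comp[OF bounded_linear_scaleR_left] assms C1_bounded_linear
      bounded_linear_next_coords)

lemma C1_observer_flow:
  assumes "\<And>i. C1 (f i)"
  shows "C1 (observer_flow f k \<theta>)"
proof -
  have "bounded_linear (\<lambda>p. fst (fst p))"
    by (rule bounded_linear_compose[OF bounded_linear_fst bounded_linear_fst])
  then have "C1 (\<lambda>p. f i (fst (fst p)))" for i
    using assms by (rule C1_comp_linear)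
  note f = this
  show ?thesis
    unfolding observer_flow_eq[abs_def]
    by (intro C1_add C1_sum C1_linear_comp[OF bounded_linear_scaleR_left] f C1_bounded_linear
        bounded_linear_compose[OF bounded_linear_observer_linear_part bounded_linear_fst])
qed

lemma lipschitz_on_scaleR_const:
  assumes "C-lipschitz_on U f"
  shows "(C * norm a)-lipschitz_on U (\<lambda>x. f x *\<^sub>R a)"
proof (rule lipschitz_onI)
  fix x y assume "x \<in> U" "y \<in> U"
  then have "dist (f x) (f y) * norm a \<le> C * dist x y * norm a"
    by (intro mult_right_mono lipschitz_onD[OF assms]) auto
  then show "dist (f x *\<^sub>R a) (f y *\<^sub>R a) \<le> C * norm a * dist x y"
    by (simp add: dist_norm mult_ac flip: scaleR_diff_left)
qed (use lipschitz_on_nonneg[OF assms] in simp)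

text \<open>A crude constant suffices: it serves only global existence and the exponential growth
  bound, and never enters the condition on r.\<close>

lemma lipschitz_triangular_field:
  fixes f :: "'n::{finite,linorder} \<Rightarrow> real^'n::_ \<Rightarrow> real"
  assumes "\<And>i. L-lipschitz_on UNIV (f i)"
  obtains C where "C-lipschitz_on UNIV (triangular_field f)"
proof -
  obtain C where "C-lipschitz_on UNIV (\<lambda>x :: real^'n::_. \<chi> i. next_coord x i)"
    using bounded_linear_imp_lipschitz[OF bounded_linear_next_coords] by blast
  then have "((\<Sum>i\<in>UNIV. L * norm (axis i 1 :: real^'n::_)) + C)-lipschitz_on UNIV (triangular_field f)"
    unfolding triangular_field_eq[abs_def]
    by (intro lipschitz_on_add lipschitz_on_sum lipschitz_on_scaleR_const assms)
  then show ?thesis by (rule that)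
qed

lemma lipschitz_observer_flow:
  fixes f :: "'n::{finite,linorder} \<Rightarrow> real^'n::_ \<Rightarrow> real"
  assumes "\<And>i. L-lipschitz_on UNIV (f i)"
  obtains C where "C-lipschitz_on UNIV (\<lambda>\<zeta>. observer_flow f k \<theta> (\<zeta>, \<zeta>', y))"
proof -
  obtain C where C: "C-lipschitz_on UNIV (observer_linear_part k \<theta>)"
    using bounded_linear_imp_lipschitz[OF bounded_linear_observer_linear_part] by blast
  obtain D where D: "D-lipschitz_on UNIV (fst :: (real^'n::_) \<times> real \<Rightarrow> _)"
    using bounded_linear_imp_lipschitz[OF bounded_linear_fst] by blast
  have "(L * D)-lipschitz_on UNIV (\<lambda>\<zeta> :: (real^'n::_) \<times> real. f i (fst \<zeta>))" for i
    by (rule lipschitz_on_compose2[OF D lipschitz_on_subset[OF assms]]) simp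
  then have "((\<Sum>i\<in>UNIV. L * D * norm (axis i 1 :: real^'n::_, 0 :: real))
      + L * D * norm (0 :: real^'n::_, 1 :: real) + C)-lipschitz_on UNIV
      (\<lambda>\<zeta>. observer_flow f k \<theta> (\<zeta>, \<zeta>', y))"
    unfolding observer_flow_eq[abs_def] fst_conv
    by (intro lipschitz_on_add lipschitz_on_sum lipschitz_on_scaleR_const C)
  then show ?thesis by (rule that)
qed

section \<open>The scaled error\<close>

text \<open>The usual high-gain coordinates. Numbering from 1 means that the first coordinate is
  divided by theta too, so that e_(i+1) / theta^i and c'e both contribute exactly one factor
  theta.\<close>

definition scaled :: "real \<Rightarrow> real^'n::{finite,linorder} \<Rightarrow> real^'n::_" where
  "scaled \<theta> e = (\<chi> i. e $ i / \<theta> ^ pos i)"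

lemma scaled_nth [simp]: "scaled \<theta> e $ i = e $ i / \<theta> ^ pos i"
  by (simp add: scaled_def)

lemma bounded_linear_scaled: "bounded_linear (scaled \<theta>)"
  by (intro linear_conv_bounded_linear[THEN iffD1] linearI)
    (auto simp: vec_eq_iff add_divide_distrib)

lemma pos_le_card: "pos (i :: 'n::{finite,linorder}) \<le> CARD('n)"
  using bij_betw_pos[where 'n='n] by (auto simp: bij_betw_def)

lemma norm_vec_mono:
  fixes x y :: "real^'n"
  assumes "\<And>i. \<bar>x $ i\<bar> \<le> \<bar>y $ i\<bar>"
  shows "norm x \<le> norm y"
  unfolding norm_vec_def using assms by (intro L2_set_mono) auto

lemma norm_scaled_le:
  assumes "1 \<le> \<theta>"
  shows "norm (scaled \<theta> e) \<le> norm e"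
proof (rule norm_vec_mono)
  fix i
  have "\<bar>e $ i\<bar> / \<theta> ^ pos i \<le> \<bar>e $ i\<bar> / 1"
    using assms by (intro divide_left_mono) auto
  then show "\<bar>scaled \<theta> e $ i\<bar> \<le> \<bar>e $ i\<bar>" using assms by simp
qed

lemma norm_le_scaled:
  fixes e :: "real^'n::{finite,linorder}"
  assumes "1 \<le> \<theta>"
  shows "norm e \<le> \<theta> ^ CARD('n) * norm (scaled \<theta> e)"
proof -
  have "norm e \<le> norm (\<theta> ^ CARD('n) *\<^sub>R scaled \<theta> e)"
  proof (rule norm_vec_mono)
    fix i :: 'n
    have "\<bar>e $ i\<bar> = \<theta> ^ pos i * \<bar>scaled \<theta> e $ i\<bar>" using assms by simp
    also have "\<dots> \<le> \<theta> ^ CARD('n) * \<bar>scaled \<theta> e $ i\<bar>"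
      using assms pos_le_card by (intro mult_right_mono power_increasing) auto
    finally show "\<bar>e $ i\<bar> \<le> \<bar>(\<theta> ^ CARD('n) *\<^sub>R scaled \<theta> e) $ i\<bar>"
      using assms by (simp add: abs_mult)
  qed
  then show ?thesis using assms by simp
qed

lemma A_mat_mult: "A_mat *v x = (\<chi> i. next_coord x i)"
proof -
  have "(\<Sum>j\<in>UNIV. (if pos j = pos i + 1 then 1 else 0) * x $ j) = next_coord x i" for i :: 'a
  proof (cases "pos i < CARD('a)")
    case True
    have "pos j = pos i + 1 \<longleftrightarrow> j = idx (pos i + 1)" for j :: 'a
      using True pos_idx[of "pos i + 1", where 'n='a] by (metis idx_pos le_add2 Suc_eq_plus1 Suc_leI)
    then have "(\<Sum>j\<in>UNIV. (if pos j = pos i + 1 then 1 else 0) * x $ j)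
      = (\<Sum>j\<in>UNIV. if j = idx (pos i + 1) then x $ j else 0)"
      by (intro sum.cong) auto
    then show ?thesis using True by (simp add: next_coord_def)
  next
    case False
    then have "pos j \<noteq> pos i + 1" for j :: 'a using pos_le_card[of j] by linarith
    then show ?thesis using False by (simp add: next_coord_def)
  qed
  then show ?thesis by (simp add: matrix_vector_mult_def A_mat_def vec_eq_iff)
qed

lemma outer_mult: "outer u v *v x = (v \<bullet> x) *\<^sub>R u"
  by (simp add: matrix_vector_mult_def outer_def vec_eq_iff inner_vec_def sum_distrib_right sum_distrib_left mult_ac)

lemma c_vec_inner: "c_vec \<bullet> x = x $ idx 1"
  by (simp add: c_vec_def inner_axis_axis inner_commute cart_eq_inner_axis)

lemma c_vec_inner_scaled:
  assumes "\<theta> \<noteq> 0"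
  shows "c_vec \<bullet> x = \<theta> * (c_vec \<bullet> scaled \<theta> (x :: real^'n::{finite,linorder}))"
  using pos_idx[of 1, where 'n='n] assms by (simp add: c_vec_inner Suc_leI)

lemma next_coord_scaled:
  fixes x :: "real^'n::{finite,linorder}"
  assumes "\<theta> \<noteq> 0"
  shows "next_coord x i / \<theta> ^ pos i = \<theta> * next_coord (scaled \<theta> x) i"
  using pos_idx[of "pos i + 1", where 'n='n] assms
  by (simp add: next_coord_def)

text \<open>Chain coupling and injection of c'e each acquire one factor theta and merge into theta
  (A + k c'). In the mismatch term the gain theta^i cancels against the scaling, so the mismatch
  acts on the scaled error with a strength independent of theta.\<close>

lemma scaled_error_derivative:
  fixes f :: "'n::{finite,linorder} \<Rightarrow> real^'n::_ \<Rightarrow> real"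
  assumes "\<theta> \<noteq> 0"
  shows "scaled \<theta> (fst (observer_flow f k \<theta> ((z, w), p)) - triangular_field f x)
    = \<theta> *\<^sub>R ((A_mat + outer k c_vec) *v scaled \<theta> (z - x))
      + scaled \<theta> (\<chi> i. f i z - f i x) - (w - first_coord x) *\<^sub>R k"
proof -
  have "fst (observer_flow f k \<theta> ((z, w), p)) = (\<chi> i. f i z + next_coord z i + \<theta> ^ pos i * k $ i * (c_vec \<bullet> z - w))"
    by (simp add: observer_flow_def split_beta)
  moreover have "c_vec \<bullet> z - w = c_vec \<bullet> (z - x) - (w - first_coord x)"
    by (simp add: c_vec_inner first_coord_def)
  ultimately have "(fst (observer_flow f k \<theta> ((z, w), p)) - triangular_field f x) $ i =
     (f i z - f i x) + next_coord (z - x) i + \<theta> ^ pos i * (k $ i * (c_vec \<bullet> (z - x) - (w - first_coord x)))" for i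
    by (simp add: triangular_field_def next_coord_diff)
  then have "scaled \<theta> (fst (observer_flow f k \<theta> ((z, w), p)) - triangular_field f x) $ i =
     (f i z - f i x) / \<theta> ^ pos i + next_coord (z - x) i / \<theta> ^ pos i
     + k $ i * (c_vec \<bullet> (z - x) - (w - first_coord x))" for i
    using assms by (simp add: add_divide_distrib)
  then have "scaled \<theta> (fst (observer_flow f k \<theta> ((z, w), p)) - triangular_field f x) $ i =
     (f i z - f i x) / \<theta> ^ pos i + \<theta> * next_coord (scaled \<theta> (z - x)) i
     + k $ i * (\<theta> * (c_vec \<bullet> scaled \<theta> (z - x)) - (w - first_coord x))" for i
    by (simp only: next_coord_scaled[OF assms] c_vec_inner_scaled[OF assms, of "z - x"])
  then show ?thesis
    by (simp add: vec_eq_iff matrix_vector_mult_add_rdistrib A_mat_mult outer_mult algebra_simps)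
qed

text \<open>This is where the triangular structure pays: only coordinates j <= i occur, and for
  those theta^j <= theta^i because theta >= 1. After division by theta^i the Lipschitz constant is
  still L, however large theta is.\<close>

lemma triangular_lipschitz_scaled:
  fixes f :: "'n::{finite,linorder} \<Rightarrow> real^'n::_ \<Rightarrow> real"
  assumes \<theta>: "1 \<le> \<theta>" and L: "0 \<le> L"
    and lip: "\<bar>f i z - f i x\<bar> \<le> L * L2_set (\<lambda>j. z $ j - x $ j) {..i}"
  shows "\<bar>f i z - f i x\<bar> \<le> L * (\<theta> ^ pos i * norm (scaled \<theta> (z - x)))"
proof -
  let ?\<xi> = "scaled \<theta> (z - x)"
  have "L2_set (\<lambda>j. z $ j - x $ j) {..i} = L2_set (\<lambda>j. \<bar>z $ j - x $ j\<bar>) {..i}"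
    by (simp add: L2_set_def)
  also have "\<dots> \<le> L2_set (\<lambda>j. \<theta> ^ pos i * \<bar>?\<xi> $ j\<bar>) {..i}"
  proof (rule L2_set_mono)
    fix j assume "j \<in> {..i}"
    then have "pos j \<le> pos i" using pos_less_iff[of i j] by (auto simp: not_less[symmetric])
    then have "\<theta> ^ pos j * \<bar>?\<xi> $ j\<bar> \<le> \<theta> ^ pos i * \<bar>?\<xi> $ j\<bar>"
      using \<theta> by (intro mult_right_mono power_increasing) auto
    then show "\<bar>z $ j - x $ j\<bar> \<le> \<theta> ^ pos i * \<bar>?\<xi> $ j\<bar>" using \<theta> by simp
  qed auto
  also have "\<dots> = \<theta> ^ pos i * L2_set (\<lambda>j. \<bar>?\<xi> $ j\<bar>) {..i}"
    using \<theta> by (simp only: L2_set_right_distrib zero_le_power)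
  also have "L2_set (\<lambda>j. \<bar>?\<xi> $ j\<bar>) {..i} \<le> norm ?\<xi>"
    unfolding norm_vec_def L2_set_def by (intro real_sqrt_le_mono) (auto intro!: sum_mono2)
  finally show ?thesis using lip L \<theta> by (meson mult_left_mono order_trans zero_le_power zero_le_one)
qed

text \<open>Each of the n coordinates is at most L times the norm of the scaled error; sqrt n comes
  from the norm of a constant vector.\<close>

lemma norm_scaled_nonlinearity_le:
  fixes f :: "'n::{finite,linorder} \<Rightarrow> real^'n::_ \<Rightarrow> real"
  assumes \<theta>: "1 \<le> \<theta>" and L: "0 \<le> L"
    and lip: "\<And>i x z. \<bar>f i x - f i z\<bar> \<le> L * L2_set (\<lambda>j. x $ j - z $ j) {..i}"
  shows "norm (scaled \<theta> (\<chi> i. f i z - f i x)) \<le> L * sqrt CARD('n) * norm (scaled \<theta> (z - x))"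
proof -
  let ?b = "L * norm (scaled \<theta> (z - x))"
  have "norm (scaled \<theta> (\<chi> i. f i z - f i x)) \<le> norm (\<chi> i :: 'n. ?b)"
  proof (rule norm_vec_mono)
    fix i
    show "\<bar>scaled \<theta> (\<chi> i. f i z - f i x) $ i\<bar> \<le> \<bar>(\<chi> i :: 'n. ?b) $ i\<bar>"
      using triangular_lipschitz_scaled[where f = f, OF \<theta> L lip] \<theta> L by (simp add: field_simps)
  qed
  also have "\<dots> = sqrt CARD('n) * ?b"
    unfolding norm_vec_def[of "\<chi> i. ?b"] using L by (simp add: L2_set_constant abs_mult)
  finally show ?thesis by (simp add: mult_ac)
qed

lemma matrix_norm_bound: "norm (M *v x) \<le> matrix_norm M * norm x"
  unfolding matrix_norm_def by (rule onorm[OF matrix_vector_mul_bounded_linear])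

lemma matrix_norm_nonneg: "0 \<le> matrix_norm M"
  unfolding matrix_norm_def by (rule onorm_pos_le[OF matrix_vector_mul_bounded_linear])

text \<open>The matrices P M and M' P are transposes of each other, so their quadratic forms agree
  and the factor 2 cancels against 2 \<mu> I.\<close>

lemma lyapunov_inequality:
  fixes P M :: "real^'n^'n"
  assumes P_sym: "symmetric_matrix P"
    and lyapunov: "negative_semidefinite (P ** M + transpose M ** P + (2 * \<mu>) *\<^sub>R mat 1)"
  shows "x \<bullet> (P *v (M *v x)) \<le> - \<mu> * (norm x)\<^sup>2"
proof -
  have "x \<bullet> ((transpose M ** P) *v x) = (M *v x) \<bullet> (P *v x)"
    by (simp add: dot_lmul_matrix flip: matrix_vector_mul_assoc)
      (metis dot_lmul_matrix inner_commute transpose_matrix_vector transpose_transpose)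
  also have "\<dots> = x \<bullet> (P *v (M *v x))"
    using P_sym unfolding symmetric_matrix_def
    by (metis dot_lmul_matrix inner_commute transpose_matrix_vector)
  finally have 1: "x \<bullet> ((transpose M ** P) *v x) = x \<bullet> (P *v (M *v x))" .
  have 2: "((2 * \<mu>) *\<^sub>R mat 1) *v x = (2 * \<mu>) *\<^sub>R x"
    by (simp add: scaleR_matrix_vector_assoc[symmetric])
  have "x \<bullet> ((P ** M + transpose M ** P + (2 * \<mu>) *\<^sub>R mat 1) *v x) \<le> 0"
    using lyapunov unfolding negative_semidefinite_def by blast
  then have "x \<bullet> (P *v (M *v x)) + x \<bullet> ((transpose M ** P) *v x) + 2 * \<mu> * (x \<bullet> x) \<le> 0"
    by (simp add: matrix_vector_mult_add_rdistrib 2 inner_add_right matrix_vector_mul_assoc)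
  then show ?thesis unfolding 1 by (simp add: dot_square_norm)
qed

lemma transpose_closed_loop: "transpose A_mat + outer c_vec k = transpose (A_mat + outer k c_vec)"
  by (simp add: transpose_def outer_def vec_eq_iff)

text \<open>The linear part dissipates 2 \<mu> \<theta> |x|^2. Half of it absorbs the nonlinearity,
  which is the purpose of the lower bound on \<theta> (used with l = L sqrt n); the other half
  remains to counter the mismatch.\<close>

lemma quadratic_form_dissipation:
  fixes P M :: "real^'n^'n"
  assumes P_sym: "symmetric_matrix P"
    and lyapunov: "negative_semidefinite (P ** M + transpose M ** P + (2 * \<mu>) *\<^sub>R mat 1)"
    and \<theta>: "0 \<le> \<theta>" "2 * matrix_norm P * l \<le> \<mu> * \<theta>"
    and F: "norm F \<le> l * norm x"
  shows "2 * (x \<bullet> (P *v (\<theta> *\<^sub>R (M *v x) + F - y *\<^sub>R k)))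
    \<le> - (\<mu> * \<theta>) * (norm x)\<^sup>2 + 2 * matrix_norm P * norm k * norm x * \<bar>y\<bar>"
proof -
  have bound: "\<bar>x \<bullet> (P *v u)\<bar> \<le> norm x * (matrix_norm P * norm u)" for u
    using Cauchy_Schwarz_ineq2[of x "P *v u"] mult_left_mono[OF matrix_norm_bound[of P u], of "norm x"]
    by simp
  have "\<theta> * (x \<bullet> (P *v (M *v x))) \<le> \<theta> * (- \<mu> * (norm x)\<^sup>2)"
    using lyapunov_inequality[OF P_sym lyapunov] \<theta> by (intro mult_left_mono)
  moreover have "2 * (x \<bullet> (P *v F)) \<le> \<mu> * \<theta> * (norm x)\<^sup>2"
  proof -
    have "x \<bullet> (P *v F) \<le> norm x * (matrix_norm P * (l * norm x))"
      using bound[of F] F matrix_norm_nonneg[of P]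
      by (meson abs_le_D1 mult_left_mono norm_ge_zero order_trans)
    then have "2 * (x \<bullet> (P *v F)) \<le> (2 * matrix_norm P * l) * (norm x)\<^sup>2"
      by (simp add: power2_eq_square mult_ac)
    also have "\<dots> \<le> \<mu> * \<theta> * (norm x)\<^sup>2" using \<theta> by (intro mult_right_mono) auto
    finally show ?thesis .
  qed
  moreover have "- (y * (x \<bullet> (P *v k))) \<le> matrix_norm P * norm k * norm x * \<bar>y\<bar>"
  proof -
    have "- (y * (x \<bullet> (P *v k))) \<le> \<bar>y\<bar> * \<bar>x \<bullet> (P *v k)\<bar>"
      by (metis abs_ge_minus_self abs_mult)
    also have "\<dots> \<le> \<bar>y\<bar> * (norm x * (matrix_norm P * norm k))"
      by (intro mult_left_mono bound) auto
    finally show ?thesis by (simp add: mult_ac)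
  qed
  ultimately show ?thesis
    by (simp add: matrix_vector_right_distrib matrix_vector_mult_diff_distrib
        matrix_vector_mult_scaleR inner_add_right inner_diff_right algebra_simps)
qed

section \<open>Hybrid solutions\<close>

lemma sampling_time_mono:
  assumes "0 < r"
  shows "strict_mono (sampling_time r d)"
  using assms by (intro strict_mono_Suc_iff[THEN iffD2]) simp

lemma sampling_time_nonneg:
  assumes "0 < r"
  shows "0 \<le> sampling_time r d j"
  using assms by (induction j) (auto intro: add_nonneg_nonneg)

lemma sampling_time_Suc_le:
  assumes "0 < r" "d \<in> Linf_loc {0..}"
  shows "sampling_time r d (Suc j) \<le> sampling_time r d j + r"
  using assms sampling_time_nonneg[of r d j] by (auto simp: Linf_loc_def)

text \<open>No accumulation of sampling times: if all of them lay below B, a bound D of d on [0,B]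
  would make every step at least r exp(- D). Since d is evaluated at single points, its bound must
  hold pointwise.\<close>

lemma sampling_time_unbounded:
  assumes r: "0 < r" and d: "d \<in> Linf_loc {0..}"
  shows "\<exists>j. B < sampling_time r d j"
proof (rule ccontr)
  assume "\<not> ?thesis"
  then have le: "sampling_time r d j \<le> B" for j by (simp add: not_less)
  then have "0 \<le> B" using le[of 0] by simp
  then obtain D where D: "\<And>t. t \<in> {0..B} \<Longrightarrow> \<bar>d t\<bar> \<le> D"
    using d unfolding Linf_loc_def bounded_iff by fastforce
  have "real j * (r * exp (- D)) \<le> sampling_time r d j" for j
  proof (induction j)
    case (Suc j)
    have "\<bar>d (sampling_time r d j)\<bar> \<le> D"
      using D le sampling_time_nonneg[OF r] by auto
    then have "r * exp (- D) \<le> r * exp (- d (sampling_time r d j))"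
      using r by (intro mult_left_mono) auto
    then show ?case using Suc by (simp add: algebra_simps)
  qed simp
  moreover obtain j where "B < real j * (r * exp (- D))"
    using ex_less_of_nat_mult[of "r * exp (- D)" B] r by auto
  ultimately show False using le[of j] by (meson not_less order_trans)
qed

lemma sampling_interval_unique:
  fixes \<tau> :: "nat \<Rightarrow> real"
  assumes "strict_mono \<tau>" "t \<in> {\<tau> i..<\<tau> (Suc i)}" "t \<in> {\<tau> j..<\<tau> (Suc j)}"
  shows "i = j"
proof -
  have "\<tau> i < \<tau> (Suc j)" "\<tau> j < \<tau> (Suc i)" using assms by auto
  then show ?thesis using strict_mono_less[OF assms(1)] by (simp add: less_Suc_eq_le)
qed

text \<open>The flow ignores the held values, so one family of global solutions
  \<open>\<psi>\<close> of an autonomous equation can be restarted at every sampling time from the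
  state after the jump.\<close>

lemma hybrid_solution_exists:
  fixes f :: "'x::euclidean_space \<Rightarrow> 'x" and g :: "'z::euclidean_space \<times> 'z \<times> real \<Rightarrow> 'z"
  assumes f: "C-lipschitz_on UNIV f" "f 0 = 0"
    and g: "\<And>\<zeta> \<zeta>' y. g (\<zeta>, \<zeta>', y) = H \<zeta>" and H: "D-lipschitz_on UNIV H" "H 0 = 0"
    and r: "0 < r" and d: "d \<in> Linf_loc {0..}"
  shows "\<exists>x \<zeta>. hybrid_solution f h g G r x0 \<zeta>0 d v x \<zeta>"
proof -
  define \<tau> where "\<tau> = sampling_time r d"
  have mono: "strict_mono \<tau>" unfolding \<tau>_def using r by (rule sampling_time_mono)
  have nonneg: "0 \<le> \<tau> j" for j unfolding \<tau>_def using r by (rule sampling_time_nonneg)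
  have less: "\<tau> j < \<tau> (Suc j)" for j using mono by (simp add: strict_mono_Suc_iff)
  obtain x where x: "x 0 = x0"
    "\<And>t. 0 \<le> t \<Longrightarrow> (x has_vector_derivative f (x t)) (at t within {0..})"
    using global_solution_exists[OF f] by blast
  obtain \<psi> where \<psi>: "\<And>a. \<psi> a 0 = a"
    "\<And>a t. 0 \<le> t \<Longrightarrow> (\<psi> a has_vector_derivative H (\<psi> a t)) (at t within {0..})"
    using global_solution_exists[OF H] by metis
  \<comment> \<open>\<open>Z j\<close> is the observer state right after time
    \<open>\<tau> j\<close>: the flow over one interval supplies the left limit to which G is
    applied.\<close>
  define Z where "Z = rec_nat \<zeta>0 (\<lambda>j a. G (\<psi> a (\<tau> (Suc j) - \<tau> j), h (x (\<tau> (Suc j))) + v (\<tau> (Suc j))))"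
  have Z: "Z 0 = \<zeta>0"
    "\<And>j. Z (Suc j) = G (\<psi> (Z j) (\<tau> (Suc j) - \<tau> j), h (x (\<tau> (Suc j))) + v (\<tau> (Suc j)))"
    by (simp_all add: Z_def)
  \<comment> \<open>The index of the sampling interval containing t. For negative t it is
    unspecified, and no condition on a solution reads it there.\<close>
  define J where "J t = (THE j. t \<in> {\<tau> j..<\<tau> (Suc j)})" for t
  have J: "J t = j" if "t \<in> {\<tau> j..<\<tau> (Suc j)}" for t j
    unfolding J_def using that sampling_interval_unique[OF mono] by blast
  define \<zeta> where "\<zeta> t = \<psi> (Z (J t)) (t - \<tau> (J t))" for t
  have \<zeta>: "\<zeta> t = \<psi> (Z j) (t - \<tau> j)" if "t \<in> {\<tau> j..<\<tau> (Suc j)}" for t j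
    using J[OF that] by (simp add: \<zeta>_def)
  have \<zeta>_\<tau>: "\<zeta> (\<tau> j) = Z j" for j using \<zeta>[of "\<tau> j" j] less \<psi>(1) by simp
  have "(\<zeta> has_vector_derivative g (\<zeta> t, a, y)) (at t within {\<tau> j..<\<tau> (Suc j)})"
    if t: "t \<in> {\<tau> j..<\<tau> (Suc j)}" for t j a y
  proof (rule has_vector_derivative_transform[OF t \<zeta>])
    have "((\<lambda>s. s - \<tau> j) has_vector_derivative 1) (at t within {\<tau> j..<\<tau> (Suc j)})"
      by (auto intro!: derivative_eq_intros)
    moreover have "(\<psi> (Z j) has_vector_derivative H (\<psi> (Z j) (t - \<tau> j)))
        (at (t - \<tau> j) within (\<lambda>s. s - \<tau> j) ` {\<tau> j..<\<tau> (Suc j)})"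
      by (rule has_vector_derivative_within_subset[OF \<psi>(2)]) (use t in auto)
    ultimately show "((\<lambda>s. \<psi> (Z j) (s - \<tau> j)) has_vector_derivative g (\<zeta> t, a, y))
        (at t within {\<tau> j..<\<tau> (Suc j)})"
      using vector_diff_chain_within[of "\<lambda>s. s - \<tau> j" 1 t "{\<tau> j..<\<tau> (Suc j)}" "\<psi> (Z j)"]
      by (simp add: g \<zeta>[OF t] o_def)
  qed
  note derivative = this
  have left: "(\<zeta> \<longlongrightarrow> \<psi> (Z j) (\<tau> (Suc j) - \<tau> j)) (at_left (\<tau> (Suc j)))" for j
  proof -
    have "continuous_on {0..} (\<psi> (Z j))"
      using \<psi>(2) by (auto simp: continuous_on_eq_continuous_within intro: has_vector_derivative_continuous)
    then have "continuous_on {\<tau> j..\<tau> (Suc j)} (\<lambda>s. \<psi> (Z j) (s - \<tau> j))"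
      by (rule continuous_on_compose2) (auto intro!: continuous_on_diff continuous_on_id continuous_on_const)
    then have "((\<lambda>s. \<psi> (Z j) (s - \<tau> j)) \<longlongrightarrow> \<psi> (Z j) (\<tau> (Suc j) - \<tau> j)) (at (\<tau> (Suc j)) within {\<tau> j..\<tau> (Suc j)})"
      using less[of j] by (auto simp: continuous_on_def)
    then have "((\<lambda>s. \<psi> (Z j) (s - \<tau> j)) \<longlongrightarrow> \<psi> (Z j) (\<tau> (Suc j) - \<tau> j)) (at_left (\<tau> (Suc j)))"
      by (simp add: at_within_Icc_at_left less)
    moreover have "eventually (\<lambda>s. \<psi> (Z j) (s - \<tau> j) = \<zeta> s) (at_left (\<tau> (Suc j)))"
      using less[of j] by (subst eventually_at_left[of "\<tau> j"]) (auto intro!: exI[of _ "\<tau> j"] \<zeta>[symmetric])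
    ultimately show ?thesis by (rule Lim_transform_eventually)
  qed
  have "\<exists>l. (\<zeta> \<longlongrightarrow> l) (at_left (\<tau> (Suc j))) \<and>
      \<zeta> (\<tau> (Suc j)) = G (l, h (x (\<tau> (Suc j))) + v (\<tau> (Suc j)))" for j
    using left[of j] unfolding \<zeta>_\<tau> Z(2) by blast
  moreover have "\<zeta> 0 = \<zeta>0" using \<zeta>_\<tau>[of 0] by (simp add: \<tau>_def Z)
  ultimately have "hybrid_solution f h g G r x0 \<zeta>0 d v x \<zeta>"
    unfolding hybrid_solution_def Let_def \<tau>_def[symmetric] using x derivative by blast
  then show ?thesis by blast
qed

text \<open>Away from positive sampling times a half-open interval is a neighbourhood within
  [0,\<infinity>). At a positive sampling time the flow gives only right continuity, and the jump
  condition has to supply the left limit. The lemma is meant for components that the jump leaves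
  unchanged.\<close>

lemma continuous_on_piecewise:
  fixes u :: "real \<Rightarrow> 'a::t2_space" and \<tau> :: "nat \<Rightarrow> real"
  assumes \<tau>0: "\<tau> 0 = 0" and unbounded: "\<forall>B. \<exists>j. B < \<tau> j" and mono: "strict_mono \<tau>"
    and cont: "\<And>j t. t \<in> {\<tau> j..<\<tau> (Suc j)} \<Longrightarrow> continuous (at t within {\<tau> j..<\<tau> (Suc j)}) u"
    and left: "\<And>j. (u \<longlongrightarrow> u (\<tau> (Suc j))) (at_left (\<tau> (Suc j)))"
  shows "continuous_on {0..} u"
proof (rule continuous_on_eq_continuous_within[THEN iffD2], rule ballI)
  fix t :: real assume t: "t \<in> {0..}"
  obtain j where j: "t \<in> {\<tau> j..<\<tau> (Suc j)}"
    using sampling_interval_exists[OF \<tau>0 unbounded] t by auto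
  note C = cont[OF j]
  have \<tau>j: "0 \<le> \<tau> j" using \<tau>0 strict_mono_mono[OF mono] by (metis monoD le0)
  consider "\<tau> j < t" | "\<tau> j = t" "j = 0" | i where "\<tau> j = t" "j = Suc i"
    using j by (cases j) force+
  then show "continuous (at t within {0..}) u"
  proof cases
    case 1
    have "at t within {\<tau> j..<\<tau> (Suc j)} = at t within {0..}"
      by (rule at_within_nhd[of _ "{\<tau> j<..<\<tau> (Suc j)}"]) (use 1 j \<tau>j in auto)
    then show ?thesis using C by simp
  next
    case 2
    have "at t within {\<tau> j..<\<tau> (Suc j)} = at t within {0..}"
      by (rule at_within_nhd[of _ "{..<\<tau> (Suc j)}"]) (use 2 j \<tau>0 in auto)
    then show ?thesis using C by simp
  next
    case 3
    have "at t within {\<tau> j<..<\<tau> (Suc j)} = at_right t"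
      by (rule at_within_nhd[of _ "{..<\<tau> (Suc j)}"]) (use 3 j in auto)
    moreover have "(u \<longlongrightarrow> u t) (at t within {\<tau> j<..<\<tau> (Suc j)})"
      using C unfolding continuous_within by (rule tendsto_within_subset) auto
    ultimately have "(u \<longlongrightarrow> u t) (at_right t)" by simp
    moreover have "(u \<longlongrightarrow> u t) (at_left t)" using left[of i] 3 by simp
    ultimately have "(u \<longlongrightarrow> u t) (at t)" by (simp add: filterlim_at_split)
    then show ?thesis unfolding continuous_within by (rule tendsto_within_subset) auto
  qed
qed

section \<open>The observer error\<close>

text \<open>Removes the artificial positive part of the initial error. Dividing by a + 1 covers a =
  0 without a case distinction.\<close>

lemma le_of_le_add_mult_eps:
  fixes x a b :: real
  assumes "\<And>\<epsilon>. 0 < \<epsilon> \<Longrightarrow> x \<le> b + a * \<epsilon>" "0 \<le> a"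
  shows "x \<le> b"
proof (rule field_le_epsilon)
  fix e :: real assume e: "0 < e"
  have "x \<le> b + a * (e / (a + 1))" by (rule assms(1)) (use assms(2) e in simp)
  also have "a * (e / (a + 1)) \<le> e" using assms e by (simp add: field_simps)
  finally show "x \<le> b + e" by simp
qed

lemma has_real_derivative_quadratic_form:
  fixes \<xi> :: "real \<Rightarrow> real^'n" and P :: "real^'n^'n"
  assumes P: "symmetric_matrix P" and \<xi>: "(\<xi> has_vector_derivative \<xi>') (at t within S)"
  shows "((\<lambda>s. \<xi> s \<bullet> (P *v \<xi> s)) has_real_derivative 2 * (\<xi> t \<bullet> (P *v \<xi>'))) (at t within S)"
proof -
  have "((\<lambda>s. P *v \<xi> s) has_vector_derivative P *v \<xi>') (at t within S)"
    by (rule bounded_linear.has_vector_derivative[OF matrix_vector_mul_bounded_linear \<xi>])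
  then have "((\<lambda>s. \<xi> s \<bullet> (P *v \<xi> s)) has_vector_derivative \<xi> t \<bullet> (P *v \<xi>') + \<xi>' \<bullet> (P *v \<xi> t)) (at t within S)"
    by (rule bounded_bilinear.has_vector_derivative[OF bounded_bilinear_inner \<xi>])
  moreover have "\<xi>' \<bullet> (P *v \<xi> t) = \<xi> t \<bullet> (P *v \<xi>')"
    using P unfolding symmetric_matrix_def
    by (metis dot_lmul_matrix inner_commute transpose_matrix_vector)
  ultimately show ?thesis by (simp add: has_real_derivative_iff_has_vector_derivative)
qed

lemma bounded_linear_first_coord: "bounded_linear first_coord"
  unfolding first_coord_def[abs_def] by (rule bounded_linear_vec_nth)

lemma abs_first_coord_le: "\<bar>first_coord x\<bar> \<le> norm x"
  unfolding first_coord_def by (rule component_le_norm_cart)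

lemma observer_flow_autonomous:
  "observer_flow f k \<theta> (\<zeta>, \<zeta>', y) = observer_flow f k \<theta> (\<zeta>, 0, 0)"
  by (simp add: observer_flow_def split_beta)

locale high_gain_observer =
  fixes f :: "'n::{finite,linorder} \<Rightarrow> real^'n::_ \<Rightarrow> real"
    and k :: "real^'n::_" and P :: "real^'n::_^'n::_"
    and L \<mu> K1 K2 \<theta> r :: real
  assumes n: "2 \<le> CARD('n)"
    and f_C1: "\<And>i. C1 (f i)"
    and f_0: "\<And>i. f i 0 = 0"
    and L: "0 \<le> L"
    and f_lip: "\<And>i x z. \<bar>f i x - f i z\<bar> \<le> L * L2_set (\<lambda>j. x $ j - z $ j) {..i}"
    and P_sym: "symmetric_matrix P"
    and mu: "0 < \<mu>"
    and lyapunov: "negative_semidefinite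
      (P ** (A_mat + outer k c_vec) + (transpose A_mat + outer c_vec k) ** P + (2 * \<mu>) *\<^sub>R mat 1)"
    and K1: "0 < K1" and K2: "0 < K2"
    and P_bounds: "\<And>x. K1 * (norm x)\<^sup>2 \<le> x \<bullet> (P *v x) \<and> x \<bullet> (P *v x) \<le> K2 * (norm x)\<^sup>2"
    and theta: "max 1 (2 * matrix_norm P * L * sqrt (real CARD('n)) / \<mu>) \<le> \<theta>"
    and r: "0 < r"
    and r_small: "2 * r * (L + \<theta>) * (matrix_norm P * norm k / \<mu>) * sqrt (K2 / K1) < 1"
begin

lemma theta_ge_1: "1 \<le> \<theta>" using theta by simp

lemma f_lipschitz: "L-lipschitz_on UNIV (f i)"
proof (rule lipschitz_onI)
  fix x z
  have "L2_set (\<lambda>j. x $ j - z $ j) {..i} \<le> norm (x - z)"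
    unfolding norm_vec_def L2_set_def by (intro real_sqrt_le_mono) (auto intro!: sum_mono2)
  then have "L * L2_set (\<lambda>j. x $ j - z $ j) {..i} \<le> L * norm (x - z)"
    using L by (rule mult_left_mono)
  then show "dist (f i x) (f i z) \<le> L * dist x z"
    using f_lip[of i x z] by (simp add: dist_norm)
qed (rule L)

text \<open>The condition on r multiplied by \<mu> \<theta> / sqrt K2. This is the strict inequality
  from which c and M are obtained, with gains \<beta> = 2 |P| |k| and \<kappa> = \<theta> (L +
  \<theta>) and dissipation \<alpha> = \<mu> \<theta>.\<close>

lemma loop_gain:
  "2 * matrix_norm P * norm k * (\<theta> * (L + \<theta>)) * r / sqrt K1 < \<mu> * \<theta> / sqrt K2"
proof -
  have "2 * matrix_norm P * norm k * (\<theta> * (L + \<theta>)) * r / sqrt K1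
      = (2 * r * (L + \<theta>) * (matrix_norm P * norm k / \<mu>) * sqrt (K2 / K1)) * (\<mu> * \<theta> / sqrt K2)"
    using K1 K2 mu by (simp add: real_sqrt_divide field_simps)
  also have "\<dots> < 1 * (\<mu> * \<theta> / sqrt K2)"
    using K2 mu theta_ge_1 by (intro mult_strict_right_mono r_small) auto
  finally show ?thesis by simp
qed

abbreviation "system \<equiv> triangular_field f"
abbreviation "flow \<zeta> \<equiv> observer_flow f k \<theta> (\<zeta>, 0, 0)"

lemma lyapunov_derivative_le:
  "2 * (scaled \<theta> (z - x) \<bullet> (P *v scaled \<theta> (fst (flow (z, w)) - system x)))
    \<le> - (\<mu> * \<theta>) * (norm (scaled \<theta> (z - x)))\<^sup>2
      + 2 * matrix_norm P * norm k * norm (scaled \<theta> (z - x)) * \<bar>w - first_coord x\<bar>"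
proof -
  have \<theta>: "\<theta> \<noteq> 0" "0 \<le> \<theta>" using theta_ge_1 by auto
  have "2 * matrix_norm P * (L * sqrt CARD('n)) \<le> \<mu> * \<theta>"
    using theta mu by (simp add: field_simps)
  then show ?thesis
    unfolding scaled_error_derivative[OF \<theta>(1)]
    by (rule quadratic_form_dissipation[OF P_sym lyapunov[unfolded transpose_closed_loop] \<theta>(2)])
      (rule norm_scaled_nonlinearity_le[OF theta_ge_1 L f_lip])
qed

text \<open>The predictor w copies the equation of x_1, so the mismatch drifts only through errors
  in z_1 and z_2. Undoing the scaling costs theta for the first and theta^2 for the second; together
  they give theta L + theta^2.\<close>

lemma output_error_derivative_le:
  "\<bar>snd (flow (z, w)) - first_coord (system x)\<bar> \<le> \<theta> * (L + \<theta>) * norm (scaled \<theta> (z - x))"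
proof -
  let ?\<xi> = "scaled \<theta> (z - x)"
  have pos: "pos (idx 1 :: 'n) = 1" "pos (idx 2 :: 'n) = 2" using n by (auto intro: pos_idx)
  have "snd (flow (z, w)) - first_coord (system x) = (f (idx 1) z - f (idx 1) x) + (z - x) $ idx 2"
    using n pos by (simp add: observer_flow_def first_coord_def triangular_field_def next_coord_def)
      (simp add: numeral_2_eq_2)
  moreover have "\<bar>f (idx 1) z - f (idx 1) x\<bar> \<le> L * (\<theta> * norm ?\<xi>)"
    using triangular_lipschitz_scaled[where f = f, OF theta_ge_1 L f_lip, of "idx 1" z x] pos by simp
  moreover have "\<bar>(z - x) $ idx 2\<bar> \<le> \<theta>\<^sup>2 * norm ?\<xi>"
  proof -
    have "\<bar>(z - x) $ idx 2\<bar> = \<theta>\<^sup>2 * \<bar>?\<xi> $ idx 2\<bar>" using theta_ge_1 pos by simp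
    also have "\<dots> \<le> \<theta>\<^sup>2 * norm ?\<xi>" by (intro mult_left_mono component_le_norm_cart) auto
    finally show ?thesis .
  qed
  ultimately have "\<bar>snd (flow (z, w)) - first_coord (system x)\<bar> \<le> L * (\<theta> * norm ?\<xi>) + \<theta>\<^sup>2 * norm ?\<xi>"
    by linarith
  then show ?thesis by (simp add: power2_eq_square algebra_simps)
qed

abbreviation "solution \<equiv>
  hybrid_solution system first_coord (observer_flow f k \<theta>) observer_jump r"

text \<open>The constants precede all data, which makes the estimate uniform in sampling schedule
  and noise. S bounds the noise only up to the time t considered, so the final estimate involves no
  later noise.\<close>

lemma error_bound_exists:
  obtains c A where "0 < c" "0 < A"
    "\<And>x0 \<zeta>0 d v x \<zeta> S t. \<lbrakk>d \<in> Linf_loc {0..}; solution x0 \<zeta>0 d v x \<zeta>; 0 \<le> t;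
      \<And>s. s \<in> {0..t} \<Longrightarrow> \<bar>v s\<bar> \<le> S\<rbrakk> \<Longrightarrow>
      norm (fst (\<zeta> t) - x t)
        \<le> A * ((norm (fst \<zeta>0 - x0) + \<bar>snd \<zeta>0 - first_coord x0\<bar>) * exp (- c * t) + S) \<and>
      \<bar>snd (\<zeta> t) - first_coord (x t)\<bar>
        \<le> A * ((norm (fst \<zeta>0 - x0) + \<bar>snd \<zeta>0 - first_coord x0\<bar>) * exp (- c * t) + S)"
proof -
  let ?\<kappa> = "\<theta> * (L + \<theta>)" and ?\<beta> = "2 * matrix_norm P * norm k" and ?\<alpha> = "\<mu> * \<theta>"
  obtain c M where c: "0 < c" and M: "0 < M" "sqrt K2 \<le> M"
    and gain: "(?\<beta> * ?\<kappa> * r / sqrt K1 + ?\<beta> / M) * exp (c * r) + 2 * c * sqrt K2 < ?\<alpha> / sqrt K2"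
    using small_gain_constants[OF loop_gain] by metis
  \<comment> \<open>The factor theta^n undoes the scaling of the error; the rest is the constant of
    the small-gain estimate.\<close>
  define A1 where "A1 = \<theta> ^ CARD('n) * (M / sqrt K1)"
  define A2 where "A2 = exp (c * r) * (1 + r * ?\<kappa> * M / sqrt K1)"
  have \<theta>: "0 < \<theta>" using theta_ge_1 by simp
  have A: "0 < A1" "0 < A2"
    using M K1 \<theta> L r by (auto simp: A1_def A2_def intro!: mult_pos_pos add_pos_nonneg)
  show thesis
  proof (rule that[of c "A1 + A2"])
    fix x0 \<zeta>0 d v x \<zeta> S and t :: real
    assume d: "d \<in> Linf_loc {0..}" and sol: "solution x0 \<zeta>0 d v x \<zeta>" and t: "0 \<le> t"
      and S: "\<And>s. s \<in> {0..t} \<Longrightarrow> \<bar>v s\<bar> \<le> S"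
    \<comment> \<open>Measured by errors and not by the size of the states: it vanishes when the
      observer starts at the true state with w equal to the true output.\<close>
    define E0 where "E0 = norm (fst \<zeta>0 - x0) + \<bar>snd \<zeta>0 - first_coord x0\<bar>"
    define \<tau> where "\<tau> = sampling_time r d"
    have \<tau>: "\<tau> 0 = 0" "\<forall>B. \<exists>j. B < \<tau> j" "\<And>j. \<tau> (Suc j) \<le> \<tau> j + r" "\<And>j. 0 \<le> \<tau> j" "strict_mono \<tau>"
      using sampling_time_unbounded[OF r d] sampling_time_Suc_le[OF r d] sampling_time_nonneg[OF r]
        sampling_time_mono[OF r] by (auto simp: \<tau>_def)
    have init: "x 0 = x0" "\<zeta> 0 = \<zeta>0"
      and x_der: "\<And>t. 0 \<le> t \<Longrightarrow> (x has_vector_derivative system (x t)) (at t within {0..})"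
      and \<zeta>_der: "\<And>j t. t \<in> {\<tau> j..<\<tau> (Suc j)} \<Longrightarrow>
        (\<zeta> has_vector_derivative flow (\<zeta> t)) (at t within {\<tau> j..<\<tau> (Suc j)})"
      and jump: "\<And>j. \<exists>l. (\<zeta> \<longlongrightarrow> l) (at_left (\<tau> (Suc j))) \<and>
        \<zeta> (\<tau> (Suc j)) = observer_jump (l, first_coord (x (\<tau> (Suc j))) + v (\<tau> (Suc j)))"
      using sol unfolding hybrid_solution_def Let_def \<tau>_def[symmetric]
      by (auto simp: observer_flow_autonomous[of _ _ _ _ "\<zeta> (\<tau> _)"])
    define \<xi> where "\<xi> s = scaled \<theta> (fst (\<zeta> s) - x s)" for s
    define \<eta> where "\<eta> s = snd (\<zeta> s) - first_coord (x s)" for s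
    define V where "V s = \<xi> s \<bullet> (P *v \<xi> s)" for s
    have x_der': "(x has_vector_derivative system (x s)) (at s within {\<tau> j..<\<tau> (Suc j)})"
      if "s \<in> {\<tau> j..<\<tau> (Suc j)}" for j s
      using that \<tau>(4)[of j] by (intro has_vector_derivative_within_subset[OF x_der]) auto
    have V_der: "(V has_real_derivative 2 * (\<xi> s \<bullet> (P *v scaled \<theta> (fst (flow (\<zeta> s)) - system (x s)))))
        (at s within {\<tau> j..<\<tau> (Suc j)})" if s: "s \<in> {\<tau> j..<\<tau> (Suc j)}" for j s
    proof -
      have "((\<lambda>s. fst (\<zeta> s) - x s) has_vector_derivative fst (flow (\<zeta> s)) - system (x s))
          (at s within {\<tau> j..<\<tau> (Suc j)})"
        by (intro has_vector_derivative_diff x_der'[OF s]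
            bounded_linear.has_vector_derivative[OF bounded_linear_fst \<zeta>_der[OF s]])
      then show ?thesis unfolding V_def[abs_def] \<xi>_def[abs_def]
        by (intro has_real_derivative_quadratic_form[OF P_sym]
            bounded_linear.has_vector_derivative[OF bounded_linear_scaled])
    qed
    have \<eta>_der: "(\<eta> has_real_derivative snd (flow (\<zeta> s)) - first_coord (system (x s)))
        (at s within {\<tau> j..<\<tau> (Suc j)})" if s: "s \<in> {\<tau> j..<\<tau> (Suc j)}" for j s
      unfolding has_real_derivative_iff_has_vector_derivative \<eta>_def[abs_def]
      by (intro has_vector_derivative_diff
          bounded_linear.has_vector_derivative[OF bounded_linear_first_coord x_der'[OF s]]
          bounded_linear.has_vector_derivative[OF bounded_linear_snd \<zeta>_der[OF s]])
    \<comment> \<open>Only z is continuous, as w jumps. This is enough, because V is built from z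
      and x alone and the mismatch is used one interval at a time.\<close>
    have z_cont: "continuous_on {0..} (\<lambda>s. fst (\<zeta> s))"
    proof (rule continuous_on_piecewise[OF \<tau>(1,2,5)])
      fix j s assume "s \<in> {\<tau> j..<\<tau> (Suc j)}"
      then show "continuous (at s within {\<tau> j..<\<tau> (Suc j)}) (\<lambda>s. fst (\<zeta> s))"
        by (intro continuous_fst has_vector_derivative_continuous[OF \<zeta>_der])
    next
      fix j
      obtain l where "(\<zeta> \<longlongrightarrow> l) (at_left (\<tau> (Suc j)))" "fst (\<zeta> (\<tau> (Suc j))) = fst l"
        using jump[of j] by (auto simp: observer_jump_def split_beta)
      then show "((\<lambda>s. fst (\<zeta> s)) \<longlongrightarrow> fst (\<zeta> (\<tau> (Suc j)))) (at_left (\<tau> (Suc j)))"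
        by (auto intro: tendsto_fst)
    qed
    have "continuous_on {0..} x"
      using x_der by (auto simp: continuous_on_eq_continuous_within intro: has_vector_derivative_continuous)
    then have "continuous_on {0..} \<xi>"
      unfolding \<xi>_def[abs_def]
      by (intro bounded_linear.continuous_on[OF bounded_linear_scaled] continuous_on_diff z_cont)
    then have V_cont: "continuous_on {0..} V"
      unfolding V_def[abs_def]
      by (intro continuous_on_inner bounded_linear.continuous_on[OF matrix_vector_mul_bounded_linear])
    have S0: "0 \<le> S" using S[of 0] t by simp
    \<comment> \<open>At j = 0 the initial mismatch is covered by E0; at every later sampling time
      the mismatch equals the measurement error.\<close>
    have reset: "\<bar>\<eta> (\<tau> j)\<bar> \<le> (E0 + \<epsilon>) * exp (- c * \<tau> j) + S" if "\<tau> j \<le> t" "0 < \<epsilon>" for j \<epsilon>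
    proof (cases j)
      case 0
      then show ?thesis using \<tau>(1) init S0 \<open>0 < \<epsilon>\<close> by (simp add: \<eta>_def E0_def add_increasing)
    next
      case (Suc i)
      have "\<eta> (\<tau> j) = v (\<tau> j)" using jump[of i] Suc by (auto simp: observer_jump_def split_beta \<eta>_def)
      then have "\<bar>\<eta> (\<tau> j)\<bar> \<le> S" using S that \<tau>(4)[of j] by simp
      moreover have "0 \<le> (E0 + \<epsilon>) * exp (- c * \<tau> j)" using \<open>0 < \<epsilon>\<close> by (simp add: E0_def)
      ultimately show ?thesis by simp
    qed
    have "norm (\<xi> t) \<le> M / sqrt K1 * ((E0 + \<epsilon>) * exp (- c * t) + S) \<and>
        \<bar>\<eta> t\<bar> \<le> A2 * ((E0 + \<epsilon>) * exp (- c * t) + S)" if "0 < \<epsilon>" for \<epsilon>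
      unfolding A2_def
    proof (rule sampled_small_gain[where V = V and \<alpha> = ?\<alpha> and \<beta> = ?\<beta> and ?K2.0 = K2 and \<tau> = \<tau> and T = t
          and V' = "\<lambda>s. 2 * (\<xi> s \<bullet> (P *v scaled \<theta> (fst (flow (\<zeta> s)) - system (x s))))"
          and \<eta>' = "\<lambda>s. snd (flow (\<zeta> s)) - first_coord (system (x s))", OF K1 K2 _ _ _ c M(1,2) gain
          \<tau>(1-4) V_cont _ _ V_der _ \<eta>_der])
      show "norm (\<xi> 0) \<le> E0 + \<epsilon>"
        using norm_scaled_le[OF theta_ge_1, of "fst \<zeta>0 - x0"] that by (simp add: \<xi>_def init E0_def)
      show "2 * (\<xi> s \<bullet> (P *v scaled \<theta> (fst (flow (\<zeta> s)) - system (x s))))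
          \<le> - ?\<alpha> * (norm (\<xi> s))\<^sup>2 + ?\<beta> * norm (\<xi> s) * \<bar>\<eta> s\<bar>" for s
        using lyapunov_derivative_le[of "fst (\<zeta> s)" "x s" "snd (\<zeta> s)"] by (simp add: \<xi>_def \<eta>_def)
      show "\<bar>snd (flow (\<zeta> s)) - first_coord (system (x s))\<bar> \<le> ?\<kappa> * norm (\<xi> s)" for s
        using output_error_derivative_le[of "fst (\<zeta> s)" "snd (\<zeta> s)" "x s"] by (simp add: \<xi>_def)
      show "0 < E0 + \<epsilon>" using that by (simp add: E0_def add_nonneg_pos)
      show "\<bar>\<eta> (\<tau> j)\<bar> \<le> (E0 + \<epsilon>) * exp (- c * \<tau> j) + S" if "\<tau> j \<le> t" for j
        using reset that \<open>0 < \<epsilon>\<close> by blast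
    qed (use P_bounds \<theta> L mu t S0 matrix_norm_nonneg[of P] in \<open>auto simp: V_def\<close>)
    note perturbed = this
    have bounds: "norm (\<xi> t) \<le> M / sqrt K1 * (E0 * exp (- c * t) + S)"
      "\<bar>\<eta> t\<bar> \<le> A2 * (E0 * exp (- c * t) + S)"
    proof -
      show "norm (\<xi> t) \<le> M / sqrt K1 * (E0 * exp (- c * t) + S)"
      proof (rule le_of_le_add_mult_eps)
        show "norm (\<xi> t) \<le> M / sqrt K1 * (E0 * exp (- c * t) + S) + M / sqrt K1 * exp (- c * t) * \<epsilon>"
          if "0 < \<epsilon>" for \<epsilon>
          using perturbed[OF that, THEN conjunct1] by (simp only: distrib_left distrib_right mult_ac add_ac)
      qed (use M K1 in simp)
      show "\<bar>\<eta> t\<bar> \<le> A2 * (E0 * exp (- c * t) + S)"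
      proof (rule le_of_le_add_mult_eps)
        show "\<bar>\<eta> t\<bar> \<le> A2 * (E0 * exp (- c * t) + S) + A2 * exp (- c * t) * \<epsilon>"
          if "0 < \<epsilon>" for \<epsilon>
          using perturbed[OF that, THEN conjunct2] by (simp only: distrib_left distrib_right mult_ac add_ac)
      qed (use A in simp)
    qed
    have nonneg: "0 \<le> E0 * exp (- c * t) + S" using S0 by (simp add: E0_def)
    have "norm (fst (\<zeta> t) - x t) \<le> \<theta> ^ CARD('n) * norm (\<xi> t)"
      unfolding \<xi>_def by (rule norm_le_scaled[OF theta_ge_1])
    also have "\<dots> \<le> \<theta> ^ CARD('n) * (M / sqrt K1 * (E0 * exp (- c * t) + S))"
      using \<theta> by (intro mult_left_mono bounds) auto
    also have "\<dots> = A1 * (E0 * exp (- c * t) + S)" by (simp add: A1_def)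
    also have "\<dots> \<le> (A1 + A2) * (E0 * exp (- c * t) + S)"
      using A nonneg by (intro mult_right_mono) auto
    finally have "norm (fst (\<zeta> t) - x t) \<le> (A1 + A2) * (E0 * exp (- c * t) + S)" .
    moreover have "\<bar>\<eta> t\<bar> \<le> (A1 + A2) * (E0 * exp (- c * t) + S)"
      using bounds(2) mult_right_mono[of A2 "A1 + A2", OF _ nonneg] A by simp
    ultimately show "norm (fst (\<zeta> t) - x t)
        \<le> (A1 + A2) * ((norm (fst \<zeta>0 - x0) + \<bar>snd \<zeta>0 - first_coord x0\<bar>) * exp (- c * t) + S) \<and>
      \<bar>snd (\<zeta> t) - first_coord (x t)\<bar>
        \<le> (A1 + A2) * ((norm (fst \<zeta>0 - x0) + \<bar>snd \<zeta>0 - first_coord x0\<bar>) * exp (- c * t) + S)"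
      by (simp add: E0_def \<eta>_def)
  qed (use c A in auto)
qed

end

section \<open>Linear and exponential comparison functions, and the supremum of the noise\<close>

lemma linear_class_N:
  assumes "0 \<le> A"
  shows "(\<lambda>s. A * s) \<in> class_N"
  using assms by (auto simp: class_N_def intro!: continuous_intros mono_onI mult_left_mono)

lemma linear_class_K:
  assumes "0 < A"
  shows "(\<lambda>s. A * s) \<in> class_K"
  using assms by (auto simp: class_K_def intro!: continuous_on_mult continuous_on_const
      continuous_on_id strict_mono_onI)

lemma linear_class_K_inf:
  assumes "0 < A"
  shows "(\<lambda>s. A * s) \<in> class_K_inf"
  using assms linear_class_K
  by (auto simp: class_K_inf_def intro: filterlim_tendsto_pos_mult_at_top[OF tendsto_const _ filterlim_ident])

lemma exponential_class_KL:
  assumes "0 < A" "0 < c"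
  shows "(\<lambda>s t. A * s * exp (- c * t)) \<in> class_KL"
proof -
  have "continuous_on ({0..} \<times> {0..}) (\<lambda>(s, t). A * s * exp (- c * t))"
    unfolding split_beta by (intro continuous_intros)
  moreover have "(\<lambda>s. A * s * exp (- c * t)) \<in> class_K" for t
    using linear_class_K[of "A * exp (- c * t)"] assms by (simp add: mult_ac)
  moreover have "antimono_on {0..} (\<lambda>t. A * s * exp (- c * t))" if "0 \<le> s" for s
    using assms that by (intro monotone_onI mult_left_mono) auto
  moreover have "((\<lambda>t. A * s * exp (- c * t)) \<longlongrightarrow> 0) at_top" for s
  proof -
    have "filterlim (\<lambda>t. - c * t) at_bot at_top"
      using assms(2) by (intro filterlim_tendsto_neg_mult_at_bot[OF tendsto_const _ filterlim_ident]) auto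
    then have "((\<lambda>t. exp (- c * t)) \<longlongrightarrow> 0) at_top"
      by (rule filterlim_compose[OF exp_at_bot])
    then show ?thesis by (rule tendsto_mult_right_zero)
  qed
  ultimately show ?thesis using assms by (auto simp: class_KL_def)
qed

text \<open>Local boundedness makes the supremum a genuine one. Dividing by A gives a noise bound S
  for which A S is exactly the supremum of the linear gain.\<close>

lemma Linf_loc_abs_le_SUP:
  assumes "v \<in> Linf_loc D" "0 < A" "s \<in> {0..t}"
  shows "\<bar>v s\<bar> \<le> (SUP s\<in>{0..t}. A * \<bar>v s\<bar>) / A"
proof -
  obtain B where B: "\<And>s. s \<in> {0..t} \<Longrightarrow> \<bar>v s\<bar> \<le> B"
  proof -
    have "bounded (v ` {0..t})" using assms(1,3) by (simp add: Linf_loc_def)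
    then show thesis using that unfolding bounded_iff by (metis image_eqI real_norm_def)
  qed
  have "A * \<bar>v s\<bar> \<le> (SUP s\<in>{0..t}. A * \<bar>v s\<bar>)"
    using assms(2,3) B by (intro cSUP_upper bdd_aboveI2[of _ _ "A * B"] mult_left_mono) auto
  then show ?thesis using assms(2) by (simp add: field_simps)
qed

section \<open>Global solutions and verification of the observer properties\<close>

context high_gain_observer
begin

lemma solution_exists:
  assumes "d \<in> Linf_loc {0..}"
  shows "\<exists>x \<zeta>. solution x0 \<zeta>0 d v x \<zeta>"
proof -
  obtain C where C: "C-lipschitz_on UNIV system"
    by (rule lipschitz_triangular_field[OF f_lipschitz])
  obtain D where D: "D-lipschitz_on UNIV flow"
    by (rule lipschitz_observer_flow[OF f_lipschitz])
  have "system 0 = 0" by (simp add: triangular_field_def f_0 next_coord_def vec_eq_iff)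
  moreover have "flow 0 = 0"
    by (simp add: observer_flow_def f_0 next_coord_def vec_eq_iff zero_prod_def)
  ultimately show ?thesis
    by (intro hybrid_solution_exists[OF C _ observer_flow_autonomous D _ r assms])
qed

lemma state_bound_exists:
  obtains C where "0 \<le> C"
    "\<And>x0 \<zeta>0 d v x \<zeta> t. \<lbrakk>solution x0 \<zeta>0 d v x \<zeta>; 0 \<le> t\<rbrakk> \<Longrightarrow> norm (x t) \<le> exp (C * t) * norm x0"
proof -
  obtain C where C: "C-lipschitz_on UNIV system"
    by (rule lipschitz_triangular_field[OF f_lipschitz])
  have "system 0 = 0" by (simp add: triangular_field_def f_0 next_coord_def vec_eq_iff)
  then show ?thesis
    using that[of C] lipschitz_on_nonneg[OF C] solution_exp_bound[OF C]
    unfolding hybrid_solution_def Let_def by metis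
qed

theorem robust: "robust_sampled_data_observer system first_coord r (observer_flow f k \<theta>) observer_jump fst"
proof -
  obtain c A where c: "0 < c" and A: "0 < A" and error:
    "\<And>x0 \<zeta>0 d v x \<zeta> S t. \<lbrakk>d \<in> Linf_loc {0..}; solution x0 \<zeta>0 d v x \<zeta>; 0 \<le> t;
      \<And>s. s \<in> {0..t} \<Longrightarrow> \<bar>v s\<bar> \<le> S\<rbrakk> \<Longrightarrow>
      norm (fst (\<zeta> t) - x t)
        \<le> A * ((norm (fst \<zeta>0 - x0) + \<bar>snd \<zeta>0 - first_coord x0\<bar>) * exp (- c * t) + S) \<and>
      \<bar>snd (\<zeta> t) - first_coord (x t)\<bar>
        \<le> A * ((norm (fst \<zeta>0 - x0) + \<bar>snd \<zeta>0 - first_coord x0\<bar>) * exp (- c * t) + S)"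
    using error_bound_exists by blast
  obtain C where C: "0 \<le> C" and state:
    "\<And>x0 \<zeta>0 d v x \<zeta> t. \<lbrakk>solution x0 \<zeta>0 d v x \<zeta>; 0 \<le> t\<rbrakk> \<Longrightarrow> norm (x t) \<le> exp (C * t) * norm x0"
    using state_bound_exists by blast
  \<comment> \<open>All comparison functions can be linear or exponential. \<open>\<gamma>\<close>
    also serves as the gain p; \<open>2 * A\<close> in \<open>\<sigma>\<close> reflects that the
    initial error is at most twice the norms of the initial states; \<open>\<nu>\<close> and
    \<open>a\<close> come from bounding z and w separately, each by the plant state plus an error,
    hence the 2 in \<open>\<nu>\<close>.\<close>
  define \<gamma> where "\<gamma> s = A * s" for s
  define \<sigma> where "\<sigma> s t = 2 * A * s * exp (- c * t)" for s t
  define a where "a s = (1 + 2 * A) * s" for s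
  define \<nu> where "\<nu> t = 2 * exp (C * t)" for t
  have classes: "\<sigma> \<in> class_KL" "\<gamma> \<in> class_N" "\<nu> \<in> class_K_plus" "a \<in> class_K_inf"
    using exponential_class_KL[of "2 * A" c] linear_class_N[of A] linear_class_K_inf[of "1 + 2 * A"] A c
    by (auto simp: \<sigma>_def[abs_def] \<gamma>_def[abs_def] \<nu>_def a_def[abs_def] class_K_plus_def intro!: continuous_intros)
  have bound: "norm (fst (\<zeta> t) - x t) \<le> \<sigma> (norm x0 + norm \<zeta>0) t + (SUP s\<in>{0..t}. \<gamma> \<bar>v s\<bar>) \<and>
      norm (\<zeta> t) \<le> \<nu> t * (a (norm x0 + norm \<zeta>0) + (SUP s\<in>{0..t}. \<gamma> \<bar>v s\<bar>))"
    if d: "d \<in> Linf_loc {0..}" and v: "v \<in> Linf_loc UNIV" and sol: "solution x0 \<zeta>0 d v x \<zeta>" and t: "0 \<le> t"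
    for x0 \<zeta>0 d v x \<zeta> t
  proof -
    define R where "R = (SUP s\<in>{0..t}. \<gamma> \<bar>v s\<bar>)"
    define E0 where "E0 = norm (fst \<zeta>0 - x0) + \<bar>snd \<zeta>0 - first_coord x0\<bar>"
    define N where "N = norm x0 + norm \<zeta>0"
    have S: "\<bar>v s\<bar> \<le> R / A" if "s \<in> {0..t}" for s
      unfolding R_def \<gamma>_def by (rule Linf_loc_abs_le_SUP[OF v A that])
    have "0 \<le> R / A" using S[of 0] t by (meson abs_ge_zero atLeastAtMost_iff order_refl order_trans)
    then have R: "0 \<le> R" using A by (simp add: zero_le_divide_iff)
    have E0: "E0 \<le> 2 * N"
    proof -
      have "norm (fst \<zeta>0 - x0) \<le> norm \<zeta>0 + norm x0"
        using norm_triangle_ineq4[of "fst \<zeta>0" x0] norm_fst_le[of "fst \<zeta>0" "snd \<zeta>0"] by simp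
      moreover have "\<bar>snd \<zeta>0 - first_coord x0\<bar> \<le> norm \<zeta>0 + norm x0"
        using norm_snd_le[of "snd \<zeta>0" "fst \<zeta>0"] abs_first_coord_le[of x0] by simp
      ultimately show ?thesis by (simp add: E0_def N_def)
    qed
    have "A * (E0 * exp (- c * t) + R / A) = A * exp (- c * t) * E0 + R" using A by (simp add: field_simps)
    also have "\<dots> \<le> A * exp (- c * t) * (2 * N) + R"
      using A E0 by (intro add_right_mono mult_left_mono) auto
    finally have le: "A * (E0 * exp (- c * t) + R / A) \<le> \<sigma> N t + R" by (simp add: \<sigma>_def mult_ac)
    have e: "norm (fst (\<zeta> t) - x t) \<le> \<sigma> N t + R" "\<bar>snd (\<zeta> t) - first_coord (x t)\<bar> \<le> \<sigma> N t + R"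
      using error[OF d sol t S] le unfolding E0_def by auto
    have N: "0 \<le> N" by (simp add: N_def)
    have \<sigma>: "\<sigma> N t \<le> 2 * A * N"
      unfolding \<sigma>_def using A N c t by (simp add: mult_left_le)
    have x: "norm (x t) \<le> exp (C * t) * N"
      by (rule order_trans[OF state[OF sol t]]) (simp add: N_def)
    have "norm (\<zeta> t) \<le> norm (fst (\<zeta> t)) + \<bar>snd (\<zeta> t)\<bar>"
      using norm_Pair_le[of "fst (\<zeta> t)" "snd (\<zeta> t)"] by simp
    also have "\<dots> \<le> (norm (x t) + norm (fst (\<zeta> t) - x t))
        + (norm (x t) + \<bar>snd (\<zeta> t) - first_coord (x t)\<bar>)"
    proof (rule add_mono)
      show "norm (fst (\<zeta> t)) \<le> norm (x t) + norm (fst (\<zeta> t) - x t)" by (rule norm_triangle_sub)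
      show "\<bar>snd (\<zeta> t)\<bar> \<le> norm (x t) + \<bar>snd (\<zeta> t) - first_coord (x t)\<bar>"
        using abs_first_coord_le[of "x t"] by linarith
    qed
    also have "\<dots> \<le> (norm (x t) + (\<sigma> N t + R)) + (norm (x t) + (\<sigma> N t + R))"
      by (intro add_mono e order_refl)
    also have "\<dots> = 2 * norm (x t) + 2 * (\<sigma> N t + R)" by simp
    also have "\<dots> \<le> 2 * (exp (C * t) * N) + 2 * (2 * A * N + R)"
      by (intro add_mono mult_left_mono x \<sigma> order_refl) auto
    also have "\<dots> \<le> 2 * (exp (C * t) * N) + 2 * exp (C * t) * (2 * A * N + R)"
    proof -
      have "1 * (2 * A * N + R) \<le> exp (C * t) * (2 * A * N + R)"
        using A N R C t by (intro mult_right_mono) auto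
      then show ?thesis by linarith
    qed
    also have "\<dots> = \<nu> t * (a N + R)" by (simp add: \<nu>_def a_def algebra_simps)
    finally show ?thesis using e(1) unfolding N_def R_def by blast
  qed
  \<comment> \<open>The start (x0, first coordinate of x0) makes both initial errors vanish, so with
    S = 0 the error estimate forces z = x.\<close>
  have exact: "x t = fst (\<zeta> t)"
    if d: "d \<in> Linf_loc {0..}" and sol: "solution x0 (x0, first_coord x0) d (\<lambda>_. 0) x \<zeta>" and t: "0 \<le> t"
    for x0 d x \<zeta> t
    using error[OF d sol t, of 0] by simp
  have basic: "C1 system" "C2 (first_coord :: real^'n::_ \<Rightarrow> real)" "system 0 = 0" "first_coord (0 :: real^'n::_) = 0"
    using C1_triangular_field f_C1 C2_bounded_linear bounded_linear_first_coord
    by (auto simp: triangular_field_def f_0 next_coord_def first_coord_def vec_eq_iff)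
  have smooth: "C1 (observer_flow f k \<theta>)" "continuous_on UNIV (observer_jump :: ((real^'n::_) \<times> real) \<times> real \<Rightarrow> _)"
    "C1 (fst :: (real^'n::_) \<times> real \<Rightarrow> _)"
    using C1_observer_flow f_C1 C1_bounded_linear bounded_linear_fst
    by (auto simp: observer_jump_def split_beta intro!: continuous_intros)
  have zero: "observer_flow f k \<theta> 0 = 0" "observer_jump (0 :: ((real^'n::_) \<times> real) \<times> real) = 0"
    by (simp_all add: observer_flow_def observer_jump_def split_beta f_0 next_coord_def vec_eq_iff zero_prod_def)
  have estimate: "the_solution_satisfies system first_coord (observer_flow f k \<theta>) observer_jump r
      x0 \<zeta>0 d v (\<lambda>x \<zeta>. \<forall>t\<ge>0.
            norm (fst (\<zeta> t) - x t) \<le> \<sigma> (norm x0 + norm \<zeta>0) t + (SUP s\<in>{0..t}. \<gamma> \<bar>v s\<bar>) \<and>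
            norm (\<zeta> t) \<le> \<nu> t * (a (norm x0 + norm \<zeta>0) + (SUP s\<in>{0..t}. \<gamma> \<bar>v s\<bar>)))"
    if "d \<in> Linf_loc {0..}" "v \<in> Linf_loc UNIV" for x0 \<zeta>0 d v
    unfolding the_solution_satisfies_def using solution_exists[OF that(1)] bound[OF that] by blast
  have tracking: "the_solution_satisfies system first_coord (observer_flow f k \<theta>) observer_jump r
      x0 (x0, first_coord x0) d (\<lambda>_. 0) (\<lambda>x \<zeta>. \<forall>t\<ge>0. x t = fst (\<zeta> t))"
    if "d \<in> Linf_loc {0..}" for x0 d
    unfolding the_solution_satisfies_def using solution_exists[OF that] exact[OF that] by blast
  have "\<exists>\<sigma>\<in>class_KL. \<exists>\<gamma>\<in>class_N. \<exists>p\<in>class_N. \<exists>\<nu>\<in>class_K_plus. \<exists>a\<in>class_K_inf.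
      \<forall>x0 \<zeta>0. \<forall>d\<in>Linf_loc {0..}. \<forall>v\<in>Linf_loc UNIV.
        the_solution_satisfies system first_coord (observer_flow f k \<theta>) observer_jump r
          x0 \<zeta>0 d v (\<lambda>x \<zeta>. \<forall>t\<ge>0.
            norm (fst (\<zeta> t) - x t) \<le> \<sigma> (norm x0 + norm \<zeta>0) t + (SUP s\<in>{0..t}. \<gamma> \<bar>v s\<bar>) \<and>
            norm (\<zeta> t) \<le> \<nu> t * (a (norm x0 + norm \<zeta>0) + (SUP s\<in>{0..t}. p \<bar>v s\<bar>)))"
    by (rule bexI[OF _ classes(1)], rule bexI[OF _ classes(2)], rule bexI[OF _ classes(2)],
        rule bexI[OF _ classes(3)], rule bexI[OF _ classes(4)], intro allI ballI, rule estimate)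
  moreover have "\<forall>x0. \<exists>\<zeta>0. \<forall>d\<in>Linf_loc {0..}.
      the_solution_satisfies system first_coord (observer_flow f k \<theta>) observer_jump r
        x0 \<zeta>0 d (\<lambda>_. 0) (\<lambda>x \<zeta>. \<forall>t\<ge>0. x t = fst (\<zeta> t))"
    by (intro allI exI ballI) (rule tracking)
  ultimately show ?thesis
    unfolding robust_sampled_data_observer_def
    by (intro conjI r basic smooth zero fst_zero)
qed

end

theorem mainTheorem2:
  fixes f :: "'n::{finite,linorder} \<Rightarrow> real^'n::_ \<Rightarrow> real"
    and k :: "real^'n::_" and P :: "real^'n::_^'n::_"
    and L \<mu> K1 K2 \<theta> r :: real
  assumes n: "2 \<le> CARD('n)"
    and f_dep: "\<And>i. depends_on_upto i (f i)"
    and f_C1: "\<And>i. C1 (f i)"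
    and f_0: "\<And>i. f i 0 = 0"
    and L: "0 \<le> L"
    and f_lip: "\<And>i x z. \<bar>f i x - f i z\<bar> \<le> L * L2_set (\<lambda>j. x $ j - z $ j) {..i}"
    and hurwitz: "hurwitz (A_mat + outer k c_vec)"
    and P_sym: "symmetric_matrix P"
    and P_pos: "positive_definite P"
    and mu: "0 < \<mu>"
    and lyapunov: "negative_semidefinite
      (P ** (A_mat + outer k c_vec) + (transpose A_mat + outer c_vec k) ** P + (2 * \<mu>) *\<^sub>R mat 1)"
    and K1: "0 < K1" and K2: "0 < K2"
    and P_bounds: "\<And>x. K1 * (norm x)\<^sup>2 \<le> x \<bullet> (P *v x) \<and> x \<bullet> (P *v x) \<le> K2 * (norm x)\<^sup>2"
    and theta: "max 1 (2 * matrix_norm P * L * sqrt (real CARD('n)) / \<mu>) \<le> \<theta>"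
    and r: "0 < r"
    and r_small: "2 * r * (L + \<theta>) * (matrix_norm P * norm k / \<mu>) * sqrt (K2 / K1) < 1"
  shows "robust_sampled_data_observer (triangular_field f) first_coord r
           (observer_flow f k \<theta>) observer_jump fst"
proof -
  interpret high_gain_observer f k P L \<mu> K1 K2 \<theta> r
    by unfold_locales (fact assms)+
  show ?thesis by (rule robust)
qed

end
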